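(* Let $G_0$ be a finite group. Let $G,U$ be subgroups of $G_0$ and let $\theta:U\to\mathbb C^\times$ be a character such that $G$ normalizes both $U$ and $\theta$. Let $H$ be a subgroup of $G$ and $U_0$ a subgroup of $U$. Let $\theta_0$ denote the restriction of $\theta$ to $U_0$. Assume further that $H$ normalizes $U_0$ and $\theta_0$. Then for any representation $(\rho,V)$ of the group $HU_0$ there is an isomorphism of $G$-modules $$\left(\mathrm{Ind}_{HU_0}^{GU}(\rho)\right)_{U,\theta}\simeq\mathrm{Ind}_H^G\left(\rho_{U_0,\theta_0}\right).$$
   Context: Representations are finite dimensional and complex. $G$ normalizes $\theta$ means $\theta(gug^{-1})=\theta(u)$ for all $g\in G$, $u\in U$; similarly for $H$ and $\theta_0$. For a representation $(\pi,V)$ of a finite group, a subgroup $U$ and a character $\theta$ of $U$, $\pi_{U,\theta}$ is the natural representation on $V/\langle\pi(u)v-\theta(u)v:u\in U,v\in V\rangle$ of any subgroup normalizing $U$ and $\theta$. $\mathrm{Ind}$ is the usual induction: functions $f$ on the larger group with $f(hg)=\rho(h)f(g)$ for $h$ in the smaller group, under right translation.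
   Formalization: The formal theorem additionally assumes that G∩U is contained in H∩U_0; without it the claim fails (G_0=G=U of order 2, H=U_0=1, θ and ρ trivial: dimensions 1 and 2), and for given G,U,H,U_0,θ the claim for all ρ forces it. *)

theory Defs
  imports "Jordan_Normal_Form.VS_Connect" "HOL-Algebra.AbelCoset"
begin

abbreviation complex_field :: "complex ring"
  where "complex_field \<equiv> class_ring"

text \<open>
  A subgroup \<open>H\<close> of \<open>G\<close> is regarded as a group through the record \<open>G\<lparr>carrier := H\<rparr>\<close>. The operators
  \<open>\<rho> g\<close> of a representation are only specified on the carrier of the space.
\<close>

locale fd_representation = group G + vectorspace complex_field V
  for G :: "('g, 'm) monoid_scheme" and V :: "(complex, 'v, 'n) module_scheme" +
  fixes \<rho> :: "'g \<Rightarrow> 'v \<Rightarrow> 'v"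
  assumes finite_dimensional: "fin_dim"
    and linear: "g \<in> carrier G \<Longrightarrow> \<rho> g \<in> LinearCombinations.module_hom complex_field V V"
    and action_one: "v \<in> carrier V \<Longrightarrow> \<rho> \<one>\<^bsub>G\<^esub> v = v"
    and action_mult: "\<lbrakk>g \<in> carrier G; h \<in> carrier G; v \<in> carrier V\<rbrakk>
      \<Longrightarrow> \<rho> (g \<otimes>\<^bsub>G\<^esub> h) v = \<rho> g (\<rho> h v)"

definition isomorphic_representations ::
    "('g, 'm) monoid_scheme \<Rightarrow> (complex, 'v, 'n) module_scheme \<Rightarrow> ('g \<Rightarrow> 'v \<Rightarrow> 'v)
      \<Rightarrow> (complex, 'w, 'k) module_scheme \<Rightarrow> ('g \<Rightarrow> 'w \<Rightarrow> 'w) \<Rightarrow> bool"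
  where "isomorphic_representations G V \<rho> W \<sigma> \<longleftrightarrow>
    fd_representation G V \<rho> \<and> fd_representation G W \<sigma> \<and>
    (\<exists>T \<in> LinearCombinations.module_hom complex_field V W. bij_betw T (carrier V) (carrier W) \<and>
      (\<forall>g \<in> carrier G. \<forall>v \<in> carrier V. T (\<rho> g v) = \<sigma> g (T v)))"

definition is_character :: "('g, 'm) monoid_scheme \<Rightarrow> ('g \<Rightarrow> complex) \<Rightarrow> bool"
  where "is_character U \<theta> \<longleftrightarrow> \<theta> \<in> hom U (units_of complex_field)"

definition normalizes_subgroup :: "('g, 'm) monoid_scheme \<Rightarrow> 'g set \<Rightarrow> 'g set \<Rightarrow> bool"
  where "normalizes_subgroup G0 G U \<longleftrightarrow> (\<forall>g \<in> G. g <#\<^bsub>G0\<^esub> U #>\<^bsub>G0\<^esub> inv\<^bsub>G0\<^esub> g = U)"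

definition normalizes_character ::
    "('g, 'm) monoid_scheme \<Rightarrow> 'g set \<Rightarrow> 'g set \<Rightarrow> ('g \<Rightarrow> complex) \<Rightarrow> bool"
  where "normalizes_character G0 G U \<theta> \<longleftrightarrow>
    (\<forall>g \<in> G. \<forall>u \<in> U. \<theta> (g \<otimes>\<^bsub>G0\<^esub> u \<otimes>\<^bsub>G0\<^esub> inv\<^bsub>G0\<^esub> g) = \<theta> u)"

text \<open>
  The fields \<open>mult\<close> and \<open>one\<close> of a module record play no role for vector spaces; below they are
  filled with zero. Functions on a group are extensional, i.e. undefined off the carrier.
\<close>

definition induced_space ::
    "('g, 'm) monoid_scheme \<Rightarrow> 'g set \<Rightarrow> (complex, 'v, 'n) module_scheme \<Rightarrow> ('g \<Rightarrow> 'v \<Rightarrow> 'v)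
      \<Rightarrow> (complex, 'g \<Rightarrow> 'v) module"
  where "induced_space G H V \<rho> =
    \<lparr>carrier = {f \<in> carrier G \<rightarrow>\<^sub>E carrier V.
        \<forall>h \<in> H. \<forall>g \<in> carrier G. f (h \<otimes>\<^bsub>G\<^esub> g) = \<rho> h (f g)},
     mult = \<lambda>f f'. \<lambda>g \<in> carrier G. \<zero>\<^bsub>V\<^esub>,
     one = \<lambda>g \<in> carrier G. \<zero>\<^bsub>V\<^esub>,
     zero = \<lambda>g \<in> carrier G. \<zero>\<^bsub>V\<^esub>,
     add = \<lambda>f f'. \<lambda>g \<in> carrier G. f g \<oplus>\<^bsub>V\<^esub> f' g,
     smult = \<lambda>c f. \<lambda>g \<in> carrier G. c \<odot>\<^bsub>V\<^esub> f g\<rparr>"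

definition induced_action :: "('g, 'm) monoid_scheme \<Rightarrow> 'g \<Rightarrow> ('g \<Rightarrow> 'v) \<Rightarrow> ('g \<Rightarrow> 'v)"
  where "induced_action G x f = (\<lambda>g \<in> carrier G. f (g \<otimes>\<^bsub>G\<^esub> x))"

text \<open>
  The quotient \<open>V/W\<close> consists of the cosets of \<open>W\<close>. The unions below, as in the multiplication of
  the library's quotient rings, give \<open>c(W + x) = W + cx\<close> and \<open>g(W + x) = W + \<pi>(g)x\<close> whenever \<open>W\<close> is
  a subspace stable under \<open>\<pi> g\<close>.
\<close>

definition quotient_space ::
    "(complex, 'v, 'n) module_scheme \<Rightarrow> 'v set \<Rightarrow> (complex, 'v set) module"
  where "quotient_space V W =
    \<lparr>carrier = a_rcosets\<^bsub>V\<^esub> W,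
     mult = \<lambda>X Y. W,
     one = W,
     zero = W,
     add = set_add V,
     smult = \<lambda>c X. \<Union>x \<in> X. W +>\<^bsub>V\<^esub> (c \<odot>\<^bsub>V\<^esub> x)\<rparr>"

definition quotient_action ::
    "(complex, 'v, 'n) module_scheme \<Rightarrow> 'v set \<Rightarrow> ('g \<Rightarrow> 'v \<Rightarrow> 'v) \<Rightarrow> 'g \<Rightarrow> 'v set \<Rightarrow> 'v set"
  where "quotient_action V W \<pi> g X = (\<Union>x \<in> X. W +>\<^bsub>V\<^esub> \<pi> g x)"

definition twisted_kernel ::
    "(complex, 'v, 'n) module_scheme \<Rightarrow> ('g \<Rightarrow> 'v \<Rightarrow> 'v) \<Rightarrow> 'g set \<Rightarrow> ('g \<Rightarrow> complex) \<Rightarrow> 'v set"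
  where "twisted_kernel V \<pi> U \<theta> = LinearCombinations.module.span complex_field V
    {\<pi> u v \<ominus>\<^bsub>V\<^esub> \<theta> u \<odot>\<^bsub>V\<^esub> v | u v. u \<in> U \<and> v \<in> carrier V}"

definition coinvariant_space ::
    "(complex, 'v, 'n) module_scheme \<Rightarrow> ('g \<Rightarrow> 'v \<Rightarrow> 'v) \<Rightarrow> 'g set \<Rightarrow> ('g \<Rightarrow> complex)
      \<Rightarrow> (complex, 'v set) module"
  where "coinvariant_space V \<pi> U \<theta> = quotient_space V (twisted_kernel V \<pi> U \<theta>)"

definition coinvariant_action ::
    "(complex, 'v, 'n) module_scheme \<Rightarrow> ('g \<Rightarrow> 'v \<Rightarrow> 'v) \<Rightarrow> 'g set \<Rightarrow> ('g \<Rightarrow> complex)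
      \<Rightarrow> 'g \<Rightarrow> 'v set \<Rightarrow> 'v set"
  where "coinvariant_action V \<pi> U \<theta> = quotient_action V (twisted_kernel V \<pi> U \<theta>) \<pi>"

end

theory Submission
  imports Defs
begin

text \<open>
  Over the complex numbers, averaging a finite group \<open>U\<close> against a character,
  \<open>e v = |U|\<^sup>-\<^sup>1 \<Sum>u. \<theta>(u)\<^sup>-\<^sup>1 \<pi>(u) v\<close>, is a projection onto the \<open>\<theta>\<close>-eigenvectors, and its kernel is
  exactly the span of the vectors \<open>\<pi>(u) v - \<theta>(u) v\<close> (\<open>twisted_kernel_eq\<close>). So a class in the
  coinvariants \<open>V\<^bsub>U,\<theta>\<^esub>\<close> is the same thing as an eigenvector, and everything that normalizes
  \<open>U\<close> and \<open>\<theta>\<close> commutes with \<open>e\<close>.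

  Apply this on both sides. On the left an eigenvector is a function \<open>f\<close> on \<open>GU\<close> with
  \<open>f(xu) = \<theta>(u) f(x)\<close>. It is determined by its values on \<open>G\<close>, and those are \<open>\<theta>\<close>-eigenvectors of
  \<open>U\<^sub>0\<close>, because \<open>\<rho>(u) f(g) = f(ug) = f(g \<cdot> g\<^sup>-\<^sup>1ug) = \<theta>(u) f(g)\<close>. Hence
  \<open>f \<mapsto> (g \<mapsto> class of (e f)(g))\<close> is a \<open>G\<close>-map from the induced space to
  \<open>Ind\<^bsub>H\<^esub>\<^bsup>G\<^esup>(\<rho>\<^bsub>U\<^sub>0,\<theta>\<^sub>0\<^esub>)\<close> whose kernel is precisely the twisted kernel (\<open>comparison_kernel\<close>).

  It is also onto (\<open>comparison_surjective\<close>). Represent the classes \<open>\<phi>(g)\<close> by eigenvectors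
  \<open>F(g)\<close> and set \<open>f(gu) = \<theta>(u) F(g)\<close>. The factorization \<open>gu\<close> is unique up to \<open>G \<inter> U\<close>, so this is
  consistent if \<open>F(gk) = \<theta>(k) F(g)\<close> for \<open>k \<in> G \<inter> U\<close>. The element \<open>gkg\<^sup>-\<^sup>1\<close> is again in
  \<open>G \<inter> U \<subseteq> H \<inter> U\<^sub>0\<close>: being in \<open>H\<close> it can be pulled out of \<open>F(gkg\<^sup>-\<^sup>1 \<cdot> g)\<close> as \<open>\<rho>(gkg\<^sup>-\<^sup>1)\<close>, and being
  in \<open>U\<^sub>0\<close> it acts on \<open>F(g)\<close> by \<open>\<theta>(gkg\<^sup>-\<^sup>1) = \<theta>(k)\<close>. The isomorphism theorem for representations
  (\<open>isomorphic_quotientI\<close>) then gives the claim.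
\<close>

section \<open>Group preliminaries\<close>

lemma (in group) mult_inv_cancel_right:
  "\<lbrakk>x \<in> carrier G; y \<in> carrier G\<rbrakk> \<Longrightarrow> x \<otimes> inv y \<otimes> y = x"
  by (simp add: m_assoc)

lemma (in group) mult_inv_cancel_left:
  "\<lbrakk>x \<in> carrier G; y \<in> carrier G\<rbrakk> \<Longrightarrow> x \<otimes> (inv x \<otimes> y) = y"
  "\<lbrakk>x \<in> carrier G; y \<in> carrier G\<rbrakk> \<Longrightarrow> inv x \<otimes> (x \<otimes> y) = y"
  by (simp_all flip: m_assoc)

lemma (in group) subgroup_mem_cancel:
  assumes "subgroup H G" and "h \<in> H" and "x \<in> carrier G"
  shows "h \<otimes> x \<in> H \<longleftrightarrow> x \<in> H"
proof
  assume "h \<otimes> x \<in> H"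
  then have "inv h \<otimes> (h \<otimes> x) \<in> H"
    using assms by (simp add: subgroup.m_closed subgroup.m_inv_closed)
  then show "x \<in> H"
    using assms subgroup.mem_carrier[OF assms(1,2)] by (simp flip: m_assoc)
qed (use assms in \<open>simp add: subgroup.m_closed\<close>)

lemma (in group) normalizes_subgroup_conjugate:
  assumes "normalizes_subgroup G A B" and "a \<in> A" and "b \<in> B"
  shows "a \<otimes> b \<otimes> inv a \<in> B"
  using assms by (force simp: normalizes_subgroup_def l_coset_def r_coset_def)

text \<open>
  Closure rests on moving a factor past the normalizing side:
  \<open>ab \<cdot> a'b' = aa' \<cdot> (a'\<^sup>-\<^sup>1ba')b'\<close> and \<open>(ab)\<^sup>-\<^sup>1 = a\<^sup>-\<^sup>1 \<cdot> ab\<^sup>-\<^sup>1a\<^sup>-\<^sup>1\<close>.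
\<close>

lemma (in group) subgroup_normalized_product:
  assumes A: "subgroup A G" and B: "subgroup B G"
    and conj: "\<And>a b. \<lbrakk>a \<in> A; b \<in> B\<rbrakk> \<Longrightarrow> a \<otimes> b \<otimes> inv a \<in> B"
  shows "subgroup (A <#> B) G"
proof (rule subgroupI)
  note AB = subgroup.mem_carrier[OF A] subgroup.mem_carrier[OF B]
  note group_simps = m_assoc mult_inv_cancel_left inv_mult_group AB
  have product: "p \<otimes> q \<in> A <#> B" if "p \<in> A" "q \<in> B" for p q
    using that by (auto simp: set_mult_def)
  show "A <#> B \<subseteq> carrier G"
    by (rule setmult_subset_G[OF subgroup.subset[OF A] subgroup.subset[OF B]])
  show "A <#> B \<noteq> {}"
    using subgroup.one_closed[OF A] subgroup.one_closed[OF B] by (auto simp: set_mult_def)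
  fix x assume "x \<in> A <#> B"
  then obtain a b where ab: "a \<in> A" "b \<in> B" "x = a \<otimes> b" by (auto simp: set_mult_def)
  have "inv x = inv a \<otimes> (a \<otimes> inv b \<otimes> inv a)"
    using ab by (simp add: group_simps)
  then show "inv x \<in> A <#> B"
    using ab conj[OF ab(1) subgroup.m_inv_closed[OF B ab(2)]] subgroup.m_inv_closed[OF A ab(1)]
    by (auto simp: set_mult_def)
  fix y assume "y \<in> A <#> B"
  then obtain a' b' where ab': "a' \<in> A" "b' \<in> B" "y = a' \<otimes> b'" by (auto simp: set_mult_def)
  have "x \<otimes> y = (a \<otimes> a') \<otimes> ((inv a' \<otimes> b \<otimes> a') \<otimes> b')"
    using ab ab' by (simp add: group_simps)
  moreover have "inv a' \<otimes> b \<otimes> a' \<in> B"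
    using conj[OF subgroup.m_inv_closed[OF A ab'(1)] ab(2)] ab' AB by simp
  ultimately show "x \<otimes> y \<in> A <#> B"
    using ab ab' by (simp add: product subgroup.m_closed[OF A] subgroup.m_closed[OF B])
qed

section \<open>Complex vector spaces and linear maps\<close>

text \<open>
  Fixing the field turns the scalar ring operations of the general theory into those of the type
  \<^typ>\<open>complex\<close>, and its side conditions on scalars disappear.
\<close>

locale complex_vectorspace = vectorspace complex_field V
  for V :: "(complex, 'v, 'n) module_scheme"
begin

lemma is_complex_vectorspace: "complex_vectorspace V" ..

lemma scale_closed [simp, intro]: "v \<in> carrier V \<Longrightarrow> a \<odot>\<^bsub>V\<^esub> v \<in> carrier V"
  using smult_closed[of a v] by simp

lemma scale_add_left:
  "v \<in> carrier V \<Longrightarrow> (a + b) \<odot>\<^bsub>V\<^esub> v = a \<odot>\<^bsub>V\<^esub> v \<oplus>\<^bsub>V\<^esub> b \<odot>\<^bsub>V\<^esub> v"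
  using smult_l_distr[of a b v] by simp

lemma scale_add_right:
  "\<lbrakk>v \<in> carrier V; w \<in> carrier V\<rbrakk> \<Longrightarrow> a \<odot>\<^bsub>V\<^esub> (v \<oplus>\<^bsub>V\<^esub> w) = a \<odot>\<^bsub>V\<^esub> v \<oplus>\<^bsub>V\<^esub> a \<odot>\<^bsub>V\<^esub> w"
  using smult_r_distr[of a v w] by simp

lemma scale_scale [simp]: "v \<in> carrier V \<Longrightarrow> a \<odot>\<^bsub>V\<^esub> (b \<odot>\<^bsub>V\<^esub> v) = (a * b) \<odot>\<^bsub>V\<^esub> v"
  using smult_assoc1[of a b v] by simp

lemma scale_one [simp]: "v \<in> carrier V \<Longrightarrow> 1 \<odot>\<^bsub>V\<^esub> v = v"
  using smult_one[of v] by simp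

lemma scale_zero_left [simp]: "v \<in> carrier V \<Longrightarrow> 0 \<odot>\<^bsub>V\<^esub> v = \<zero>\<^bsub>V\<^esub>"
  using lmult_0[of v] by simp

lemma scale_zero_right [simp]: "a \<odot>\<^bsub>V\<^esub> \<zero>\<^bsub>V\<^esub> = \<zero>\<^bsub>V\<^esub>"
  using rmult_0[of a] by simp

lemma scale_minus_one: "v \<in> carrier V \<Longrightarrow> (- 1) \<odot>\<^bsub>V\<^esub> v = \<ominus>\<^bsub>V\<^esub> v"
  using M.minus_equality[of "(- 1) \<odot>\<^bsub>V\<^esub> v" v] scale_add_left[of v "- 1" 1] by simp

lemma scale_finsum:
  "g \<in> A \<rightarrow> carrier V \<Longrightarrow> c \<odot>\<^bsub>V\<^esub> finsum V g A = finsum V (\<lambda>x. c \<odot>\<^bsub>V\<^esub> g x) A"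
  using finsum_smult[of c g A] by simp

text \<open>
  With \<open>P\<close> constantly true this evaluates the sum of a constant; in general it counts the indices
  that contribute when a sum has a single value repeated.
\<close>

lemma finsum_indicator:
  assumes "finite A" and v: "v \<in> carrier V"
  shows "finsum V (\<lambda>x. if P x then v else \<zero>\<^bsub>V\<^esub>) A = of_nat (card {x \<in> A. P x}) \<odot>\<^bsub>V\<^esub> v"
  using assms(1)
proof induction
  case empty
  then show ?case using v by simp
next
  case (insert x A)
  have "{y \<in> insert x A. P y} = (if P x then insert x {y \<in> A. P y} else {y \<in> A. P y})"
    by auto
  with insert v show ?case
    by (simp add: Pi_def scale_add_left)
qed

lemma finsum_reindex_bij:
  assumes "bij_betw h A B" and "f \<in> B \<rightarrow> carrier V"
  shows "finsum V (\<lambda>x. f (h x)) A = finsum V f B"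
  using assms add.finprod_reindex[of f h A] by (auto simp: bij_betw_def)

lemma subspace_scale:
  assumes W: "subspace complex_field W V" and w: "w \<in> W"
  shows "c \<odot>\<^bsub>V\<^esub> w \<in> W"
  using submodule.smult_closed[OF is_module[OF W] _ w, of c] by simp

lemma subspace_finsum:
  assumes W: "subspace complex_field W V" and "g \<in> A \<rightarrow> W"
  shows "finsum V g A \<in> W"
proof -
  interpret submodule complex_field W V using W by (rule is_module)
  show ?thesis using assms(2)
  proof (induction A rule: infinite_finite_induct)
    case (insert x A)
    with subset have "g x \<in> carrier V" "g \<in> A \<rightarrow> carrier V" by auto
    with insert show ?case by (simp add: M.finsum_insert)
  qed simp_all
qed

end

sublocale fd_representation \<subseteq> complex_vectorspace V ..

lemma complex_vectorspaceI:
  fixes V :: "(complex, 'v, 'n) module_scheme"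
  assumes "\<zero>\<^bsub>V\<^esub> \<in> carrier V"
    and "\<And>v w. \<lbrakk>v \<in> carrier V; w \<in> carrier V\<rbrakk> \<Longrightarrow> v \<oplus>\<^bsub>V\<^esub> w \<in> carrier V"
    and "\<And>c v. v \<in> carrier V \<Longrightarrow> c \<odot>\<^bsub>V\<^esub> v \<in> carrier V"
    and "\<And>v w. \<lbrakk>v \<in> carrier V; w \<in> carrier V\<rbrakk> \<Longrightarrow> v \<oplus>\<^bsub>V\<^esub> w = w \<oplus>\<^bsub>V\<^esub> v"
    and "\<And>v w x. \<lbrakk>v \<in> carrier V; w \<in> carrier V; x \<in> carrier V\<rbrakk>
      \<Longrightarrow> (v \<oplus>\<^bsub>V\<^esub> w) \<oplus>\<^bsub>V\<^esub> x = v \<oplus>\<^bsub>V\<^esub> (w \<oplus>\<^bsub>V\<^esub> x)"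
    and "\<And>v. v \<in> carrier V \<Longrightarrow> v \<oplus>\<^bsub>V\<^esub> \<zero>\<^bsub>V\<^esub> = v"
    and "\<And>v. v \<in> carrier V \<Longrightarrow> v \<oplus>\<^bsub>V\<^esub> (- 1) \<odot>\<^bsub>V\<^esub> v = \<zero>\<^bsub>V\<^esub>"
    and "\<And>a b v. v \<in> carrier V \<Longrightarrow> (a * b) \<odot>\<^bsub>V\<^esub> v = a \<odot>\<^bsub>V\<^esub> (b \<odot>\<^bsub>V\<^esub> v)"
    and "\<And>v. v \<in> carrier V \<Longrightarrow> 1 \<odot>\<^bsub>V\<^esub> v = v"
    and "\<And>a b v. v \<in> carrier V \<Longrightarrow> (a + b) \<odot>\<^bsub>V\<^esub> v = a \<odot>\<^bsub>V\<^esub> v \<oplus>\<^bsub>V\<^esub> b \<odot>\<^bsub>V\<^esub> v"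
    and "\<And>a v w. \<lbrakk>v \<in> carrier V; w \<in> carrier V\<rbrakk>
      \<Longrightarrow> a \<odot>\<^bsub>V\<^esub> (v \<oplus>\<^bsub>V\<^esub> w) = a \<odot>\<^bsub>V\<^esub> v \<oplus>\<^bsub>V\<^esub> a \<odot>\<^bsub>V\<^esub> w"
  shows "complex_vectorspace V"
proof -
  have "\<forall>v \<in> carrier V. \<exists>w \<in> carrier V. v \<oplus>\<^bsub>V\<^esub> w = \<zero>\<^bsub>V\<^esub>"
    using assms(3,7) by blast
  then show ?thesis
    unfolding complex_vectorspace_def
    by (intro vs_criteria) (use assms in \<open>auto simp: class_field\<close>)
qed

locale complex_linear_map = V: complex_vectorspace V + W: complex_vectorspace W
  for V :: "(complex, 'v, 'n) module_scheme" and W :: "(complex, 'w, 'k) module_scheme" +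
  fixes T :: "'v \<Rightarrow> 'w"
  assumes hom: "T \<in> LinearCombinations.module_hom complex_field V W"
begin

lemma map_closed [simp, intro]: "v \<in> carrier V \<Longrightarrow> T v \<in> carrier W"
  using hom by (auto simp: LinearCombinations.module_hom_def)

lemma map_add: "\<lbrakk>v \<in> carrier V; w \<in> carrier V\<rbrakk> \<Longrightarrow> T (v \<oplus>\<^bsub>V\<^esub> w) = T v \<oplus>\<^bsub>W\<^esub> T w"
  using hom by (auto simp: LinearCombinations.module_hom_def)

lemma map_scale: "v \<in> carrier V \<Longrightarrow> T (c \<odot>\<^bsub>V\<^esub> v) = c \<odot>\<^bsub>W\<^esub> T v"
  using hom by (auto simp: LinearCombinations.module_hom_def)

lemma map_zero [simp]: "T \<zero>\<^bsub>V\<^esub> = \<zero>\<^bsub>W\<^esub>"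
  using map_scale[of "\<zero>\<^bsub>V\<^esub>" 0] by simp

lemma map_minus:
  assumes "v \<in> carrier V" and "w \<in> carrier V"
  shows "T (v \<ominus>\<^bsub>V\<^esub> w) = T v \<ominus>\<^bsub>W\<^esub> T w"
  using assms
  by (simp add: V.M.minus_eq W.M.minus_eq map_add map_scale flip: V.scale_minus_one W.scale_minus_one)

lemma kernel_subspace: "subspace complex_field {v \<in> carrier V. T v = \<zero>\<^bsub>W\<^esub>} V"
  by unfold_locales (auto simp: map_add map_scale)

lemma map_finsum: "g \<in> A \<rightarrow> carrier V \<Longrightarrow> T (finsum V g A) = finsum W (\<lambda>x. T (g x)) A"
proof (induction A rule: infinite_finite_induct)
  case (insert x A)
  then have "g x \<in> carrier V" "g \<in> A \<rightarrow> carrier V" "finsum V g A \<in> carrier V"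
    by (auto intro!: V.M.finsum_closed)
  with insert show ?case
    by (simp add: V.M.finsum_insert W.M.finsum_insert Pi_def map_add)
qed auto

end

lemma module_homI:
  fixes V :: "(complex, 'v, 'n) module_scheme" and W :: "(complex, 'w, 'k) module_scheme"
  assumes "\<And>v. v \<in> carrier V \<Longrightarrow> T v \<in> carrier W"
    and "\<And>v w. \<lbrakk>v \<in> carrier V; w \<in> carrier V\<rbrakk> \<Longrightarrow> T (v \<oplus>\<^bsub>V\<^esub> w) = T v \<oplus>\<^bsub>W\<^esub> T w"
    and "\<And>c v. v \<in> carrier V \<Longrightarrow> T (c \<odot>\<^bsub>V\<^esub> v) = c \<odot>\<^bsub>W\<^esub> T v"
  shows "T \<in> LinearCombinations.module_hom complex_field V W"
  using assms by (auto simp: LinearCombinations.module_hom_def)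

lemma complex_linear_mapI:
  assumes "complex_vectorspace V" and "complex_vectorspace W"
    and "T \<in> LinearCombinations.module_hom complex_field V W"
  shows "complex_linear_map V W T"
  using assms by (simp add: complex_linear_map_def complex_linear_map_axioms_def)

text \<open>
  If \<open>B\<close> generates \<open>V\<close>, the finite set of all \<open>T i b\<close> with \<open>b \<in> B\<close> generates \<open>W\<close>. One map gives
  finite dimensionality of quotients; one map per group element gives that of induced spaces.
\<close>

lemma fin_dim_of_finite_sum_of_images:
  fixes V :: "(complex, 'v, 'n) module_scheme" and W :: "(complex, 'w, 'k) module_scheme"
  assumes V: "complex_vectorspace V" and W: "complex_vectorspace W" and "finite I"
    and T: "\<And>i. i \<in> I \<Longrightarrow> T i \<in> LinearCombinations.module_hom complex_field V W"
    and fd: "vectorspace.fin_dim complex_field V"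
    and sum: "\<And>w. w \<in> carrier W \<Longrightarrow> \<exists>v \<in> I \<rightarrow> carrier V. w = finsum W (\<lambda>i. T i (v i)) I"
  shows "vectorspace.fin_dim complex_field W"
proof -
  interpret V: complex_vectorspace V by fact
  interpret W: complex_vectorspace W by fact
  obtain B where B: "finite B" "B \<subseteq> carrier V" "V.span B = carrier V"
    using fd unfolding V.fin_dim_def by auto
  define C where "C = (\<Union>i \<in> I. T i ` B)"
  have TV: "T i v \<in> carrier W" if "i \<in> I" "v \<in> carrier V" for i v
    using T[OF that(1)] that(2) by (auto simp: LinearCombinations.module_hom_def)
  have C: "finite C" "C \<subseteq> carrier W"
    using B TV \<open>finite I\<close> by (auto simp: C_def)
  have span: "subspace complex_field (W.span C) W"
    by (rule W.span_is_subspace[OF C(2)])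
  have image: "T i v \<in> W.span C" if i: "i \<in> I" and v: "v \<in> carrier V" for i v
  proof -
    interpret Ti: complex_linear_map V W "T i"
      by (rule complex_linear_mapI[OF V W T[OF i]])
    obtain a where "v = V.lincomb a B"
      using v B V.finite_in_span by metis
    then have "T i v = finsum W (\<lambda>b. T i (a b \<odot>\<^bsub>V\<^esub> b)) B"
      unfolding V.lincomb_def using B(2) by (auto intro!: Ti.map_finsum)
    moreover have "T i (a b \<odot>\<^bsub>V\<^esub> b) \<in> W.span C" if "b \<in> B" for b
    proof -
      have "T i b \<in> W.span C"
        using that i W.in_own_span[OF C(2)] by (auto simp: C_def)
      moreover have "b \<in> carrier V" using that B by auto
      ultimately show ?thesis by (simp add: Ti.map_scale W.subspace_scale[OF span])
    qed
    ultimately show ?thesis by (auto intro!: W.subspace_finsum[OF span])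
  qed
  have "carrier W \<subseteq> W.span C"
  proof
    fix w assume "w \<in> carrier W"
    then obtain v where v: "v \<in> I \<rightarrow> carrier V" "w = finsum W (\<lambda>i. T i (v i)) I"
      using sum by blast
    with image show "w \<in> W.span C" by (auto intro!: W.subspace_finsum[OF span])
  qed
  then have "W.span C = carrier W"
    using W.span_is_subset2[OF C(2)] by auto
  with C show ?thesis unfolding W.fin_dim_def by auto
qed

section \<open>Quotients by a stable subspace\<close>

text \<open>
  A map constant on cosets descends to the quotient by evaluation at any element of the coset.
\<close>

definition quotient_lift :: "('v \<Rightarrow> 'w) \<Rightarrow> 'v set \<Rightarrow> 'w"
  where "quotient_lift T X = T (SOME x. x \<in> X)"

locale quotient = complex_vectorspace V for V :: "(complex, 'v, 'n) module_scheme" +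
  fixes W
  assumes subspace: "subspace complex_field W V"
begin

sublocale submodule complex_field W V
  using subspace by (rule is_module)

sublocale abelian_subgroup W V
proof (rule abelian_subgroupI3)
  show "additive_subgroup W V"
  proof (rule additive_subgroupI)
    show "subgroup W (add_monoid V)"
    proof (rule add.subgroupI)
      show "\<ominus>\<^bsub>V\<^esub> w \<in> W" if "w \<in> W" for w
        using subspace_scale[OF subspace that, of "- 1"] scale_minus_one[OF subsetD[OF subset that]]
        by metis
      show "W \<noteq> {}" using submodule.zero_closed[OF is_module[OF subspace]] by blast
    qed (use subset in auto)
  qed
qed unfold_locales

abbreviation "Q \<equiv> quotient_space V W"

lemma mem_coset_iff:
  assumes "x \<in> carrier V" and "y \<in> carrier V"
  shows "y \<in> W +>\<^bsub>V\<^esub> x \<longleftrightarrow> y \<ominus>\<^bsub>V\<^esub> x \<in> W"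
  using assms by (simp add: a_rcos_module M.minus_eq)

lemma coset_eq_iff:
  assumes "x \<in> carrier V" and "y \<in> carrier V"
  shows "W +>\<^bsub>V\<^esub> x = W +>\<^bsub>V\<^esub> y \<longleftrightarrow> x \<ominus>\<^bsub>V\<^esub> y \<in> W"
  using assms a_repr_independence'[of x y] a_rcos_self[of x] mem_coset_iff[of y x] by metis

lemma carrier_quotient: "carrier Q = (\<lambda>x. W +>\<^bsub>V\<^esub> x) ` carrier V"
  by (auto simp: quotient_space_def A_RCOSETS_def')

lemma zero_quotient: "\<zero>\<^bsub>Q\<^esub> = W +>\<^bsub>V\<^esub> \<zero>\<^bsub>V\<^esub>"
  using subset by (simp add: quotient_space_def)

lemma add_quotient:
  "\<lbrakk>x \<in> carrier V; y \<in> carrier V\<rbrakk> \<Longrightarrow> (W +>\<^bsub>V\<^esub> x) \<oplus>\<^bsub>Q\<^esub> (W +>\<^bsub>V\<^esub> y) = W +>\<^bsub>V\<^esub> (x \<oplus>\<^bsub>V\<^esub> y)"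
  by (simp add: quotient_space_def a_rcos_sum)

text \<open>
  The union in the definitions of scalar multiplication and of the action on a quotient runs over
  all representatives; for a linear map that preserves \<open>W\<close> they all contribute the same coset.
\<close>

lemma coset_union:
  assumes T: "T \<in> LinearCombinations.module_hom complex_field V V" and W: "T ` W \<subseteq> W"
    and x: "x \<in> carrier V"
  shows "(\<Union>y \<in> W +>\<^bsub>V\<^esub> x. W +>\<^bsub>V\<^esub> T y) = W +>\<^bsub>V\<^esub> T x"
proof -
  interpret T: complex_linear_map V V T
    by (intro complex_linear_mapI is_complex_vectorspace T)
  show ?thesis
  proof (rule SUP_eq_const)
    show "W +>\<^bsub>V\<^esub> x \<noteq> {}" using a_rcos_self[OF x] by blast
    fix y assume yx: "y \<in> W +>\<^bsub>V\<^esub> x"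
    with x have y: "y \<in> carrier V" using a_elemrcos_carrier by blast
    with yx x have "T (y \<ominus>\<^bsub>V\<^esub> x) \<in> W" using W mem_coset_iff[of x y] by blast
    with x y show "W +>\<^bsub>V\<^esub> T y = W +>\<^bsub>V\<^esub> T x" by (simp add: coset_eq_iff T.map_minus)
  qed
qed

lemma scale_quotient:
  assumes "x \<in> carrier V"
  shows "c \<odot>\<^bsub>Q\<^esub> (W +>\<^bsub>V\<^esub> x) = W +>\<^bsub>V\<^esub> (c \<odot>\<^bsub>V\<^esub> x)"
proof -
  have "(\<lambda>v. c \<odot>\<^bsub>V\<^esub> v) \<in> LinearCombinations.module_hom complex_field V V"
    by (rule module_homI) (auto simp: scale_add_right mult.commute)
  moreover have "(\<lambda>v. c \<odot>\<^bsub>V\<^esub> v) ` W \<subseteq> W"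
    using subspace_scale[OF subspace] by blast
  ultimately show ?thesis
    using coset_union[OF _ _ assms] by (simp add: quotient_space_def)
qed

lemma quotient_vectorspace: "complex_vectorspace Q"
  by (rule complex_vectorspaceI)
    (auto simp: carrier_quotient zero_quotient add_quotient scale_quotient scale_add_left
      scale_add_right M.add.m_ac M.r_neg scale_minus_one)

lemma coset_hom: "(\<lambda>x. W +>\<^bsub>V\<^esub> x) \<in> LinearCombinations.module_hom complex_field V Q"
  by (rule module_homI) (auto simp: carrier_quotient add_quotient scale_quotient)

lemma quotient_fin_dim:
  assumes "fin_dim"
  shows "vectorspace.fin_dim complex_field Q"
proof -
  interpret Q: complex_vectorspace Q by (rule quotient_vectorspace)
  show ?thesis
  proof (rule fin_dim_of_finite_sum_of_images[where I = "{()}" and T = "\<lambda>_ x. W +>\<^bsub>V\<^esub> x"])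
    fix X assume "X \<in> carrier Q"
    then obtain x where x: "x \<in> carrier V" "X = W +>\<^bsub>V\<^esub> x" by (auto simp: carrier_quotient)
    then show "\<exists>v \<in> {()} \<rightarrow> carrier V. X = finsum Q (\<lambda>i. W +>\<^bsub>V\<^esub> v i) {()}"
      using carrier_quotient by (intro bexI[of _ "\<lambda>_. x"]) auto
  qed (use assms coset_hom in \<open>auto intro: quotient_vectorspace is_complex_vectorspace\<close>)
qed

lemma quotient_action_coset:
  assumes "\<pi> g \<in> LinearCombinations.module_hom complex_field V V" and "\<pi> g ` W \<subseteq> W"
    and "x \<in> carrier V"
  shows "quotient_action V W \<pi> g (W +>\<^bsub>V\<^esub> x) = W +>\<^bsub>V\<^esub> \<pi> g x"
  using coset_union[OF assms] by (simp add: quotient_action_def)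

lemma quotient_lift_coset:
  assumes T: "T \<in> LinearCombinations.module_hom complex_field V V'"
    and V': "complex_vectorspace V'"
    and W: "\<And>w. w \<in> W \<Longrightarrow> T w = \<zero>\<^bsub>V'\<^esub>" and x: "x \<in> carrier V"
  shows "quotient_lift T (W +>\<^bsub>V\<^esub> x) = T x"
proof -
  interpret T: complex_linear_map V V' T
    by (intro complex_linear_mapI is_complex_vectorspace V' T)
  define y where "y = (SOME y. y \<in> W +>\<^bsub>V\<^esub> x)"
  have "y \<in> W +>\<^bsub>V\<^esub> x"
    unfolding y_def using a_rcos_self[OF x] by (rule someI)
  then have y: "y \<in> carrier V" "y \<ominus>\<^bsub>V\<^esub> x \<in> W"
    using x a_elemrcos_carrier mem_coset_iff[of x y] by blast+
  then have "T y \<ominus>\<^bsub>V'\<^esub> T x = \<zero>\<^bsub>V'\<^esub>"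
    using W[OF y(2)] x by (simp add: T.map_minus)
  then have "T y = T x"
    using x y by simp
  then show ?thesis by (simp add: quotient_lift_def y_def)
qed

end

lemma quotient_representation:
  assumes rep: "fd_representation G V \<pi>" and L: "subgroup L G"
    and W: "subspace complex_field W V" and stable: "\<And>g. g \<in> L \<Longrightarrow> \<pi> g ` W \<subseteq> W"
  shows "fd_representation (G\<lparr>carrier := L\<rparr>) (quotient_space V W) (quotient_action V W \<pi>)"
proof -
  interpret fd_representation G V \<pi> by fact
  interpret quotient V W
    by (intro quotient.intro quotient_axioms.intro is_complex_vectorspace W)
  interpret Q: complex_vectorspace Q by (rule quotient_vectorspace)
  have LG: "g \<in> carrier G" if "g \<in> L" for g using subgroup.subset[OF L] that by auto
  have action: "quotient_action V W \<pi> g (W +>\<^bsub>V\<^esub> x) = W +>\<^bsub>V\<^esub> \<pi> g x"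
    if "g \<in> L" "x \<in> carrier V" for g x
    using that by (intro quotient_action_coset linear LG stable)
  have closed: "\<pi> g x \<in> carrier V" if "g \<in> L" "x \<in> carrier V" for g x
    using linear[OF LG[OF that(1)]] that(2) by (auto simp: LinearCombinations.module_hom_def)
  show ?thesis
  proof (intro fd_representation.intro fd_representation_axioms.intro)
    show "group (G\<lparr>carrier := L\<rparr>)" by (rule subgroup.subgroup_is_group[OF L is_group])
    show "vectorspace complex_field Q" by unfold_locales
    show "Q.fin_dim" by (rule quotient_fin_dim[OF finite_dimensional])
  next
    fix g assume "g \<in> carrier (G\<lparr>carrier := L\<rparr>)"
    then have g: "g \<in> L" by simp
    interpret g: complex_linear_map V V "\<pi> g"
      by (intro complex_linear_mapI is_complex_vectorspace linear LG g)
    show "quotient_action V W \<pi> g \<in> LinearCombinations.module_hom complex_field Q Q"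
      by (rule module_homI)
        (auto simp: carrier_quotient add_quotient scale_quotient action g g.map_add g.map_scale)
  next
    fix X assume "X \<in> carrier Q"
    then show "quotient_action V W \<pi> \<one>\<^bsub>G\<lparr>carrier := L\<rparr>\<^esub> X = X"
      using subgroup.one_closed[OF L] by (auto simp: carrier_quotient action action_one)
  next
    fix g h X
    assume "g \<in> carrier (G\<lparr>carrier := L\<rparr>)" "h \<in> carrier (G\<lparr>carrier := L\<rparr>)" "X \<in> carrier Q"
    then show "quotient_action V W \<pi> (g \<otimes>\<^bsub>G\<lparr>carrier := L\<rparr>\<^esub> h) X
        = quotient_action V W \<pi> g (quotient_action V W \<pi> h X)"
      using subgroup.m_closed[OF L]
      by (auto simp: carrier_quotient action action_mult LG closed)
  qed
qed

text \<open>
  The first isomorphism theorem for representations. Two groups occur because coinvariants are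
  formed in a representation of \<open>G\<close> but carry an action only of a subgroup \<open>L\<close> that stabilizes \<open>W\<close>.
\<close>

lemma isomorphic_quotientI:
  assumes rep: "fd_representation G V \<pi>" and L: "subgroup L G"
    and W: "subspace complex_field W V" and stable: "\<And>g. g \<in> L \<Longrightarrow> \<pi> g ` W \<subseteq> W"
    and rep': "fd_representation (G\<lparr>carrier := L\<rparr>) V' \<sigma>"
    and T: "T \<in> LinearCombinations.module_hom complex_field V V'"
    and surj: "T ` carrier V = carrier V'"
    and kernel: "\<And>v. v \<in> carrier V \<Longrightarrow> T v = \<zero>\<^bsub>V'\<^esub> \<longleftrightarrow> v \<in> W"
    and equivariant: "\<And>g v. \<lbrakk>g \<in> L; v \<in> carrier V\<rbrakk> \<Longrightarrow> T (\<pi> g v) = \<sigma> g (T v)"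
  shows "isomorphic_representations (G\<lparr>carrier := L\<rparr>)
    (quotient_space V W) (quotient_action V W \<pi>) V' \<sigma>"
proof -
  interpret fd_representation G V \<pi> by fact
  interpret quotient V W
    by (intro quotient.intro quotient_axioms.intro is_complex_vectorspace W)
  interpret V': fd_representation "G\<lparr>carrier := L\<rparr>" V' \<sigma> by fact
  interpret T: complex_linear_map V V' T
    by (intro complex_linear_mapI is_complex_vectorspace V'.is_complex_vectorspace T)
  have LG: "g \<in> carrier G" if "g \<in> L" for g using subgroup.subset[OF L] that by auto
  have closed: "\<pi> g x \<in> carrier V" if "g \<in> L" "x \<in> carrier V" for g x
    using linear[OF LG[OF that(1)]] that(2) by (auto simp: LinearCombinations.module_hom_def)
  have lift: "quotient_lift T (W +>\<^bsub>V\<^esub> x) = T x" if "x \<in> carrier V" for x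
    by (rule quotient_lift_coset[OF T V'.is_complex_vectorspace _ that]) (use kernel subset in auto)
  have "quotient_lift T \<in> LinearCombinations.module_hom complex_field Q V'"
    by (rule module_homI)
      (auto simp: carrier_quotient add_quotient scale_quotient lift T.map_add T.map_scale)
  moreover have "bij_betw (quotient_lift T) (carrier Q) (carrier V')"
  proof (rule bij_betw_imageI)
    show "inj_on (quotient_lift T) (carrier Q)"
    proof (rule inj_onI)
      fix X Y assume "X \<in> carrier Q" "Y \<in> carrier Q" and eq: "quotient_lift T X = quotient_lift T Y"
      then obtain x y where xy: "x \<in> carrier V" "X = W +>\<^bsub>V\<^esub> x" "y \<in> carrier V" "Y = W +>\<^bsub>V\<^esub> y"
        by (auto simp: carrier_quotient)
      with eq have "T x = T y" by (simp add: lift)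
      with xy have "T (x \<ominus>\<^bsub>V\<^esub> y) = \<zero>\<^bsub>V'\<^esub>" by (simp add: T.map_minus)
      with xy kernel[of "x \<ominus>\<^bsub>V\<^esub> y"] show "X = Y" by (simp add: coset_eq_iff)
    qed
    show "quotient_lift T ` carrier Q = carrier V'"
      using surj by (auto simp: carrier_quotient image_image lift)
  qed
  moreover have "quotient_lift T (quotient_action V W \<pi> g X) = \<sigma> g (quotient_lift T X)"
    if "g \<in> L" "X \<in> carrier Q" for g X
  proof -
    obtain x where "x \<in> carrier V" "X = W +>\<^bsub>V\<^esub> x" using \<open>X \<in> carrier Q\<close> by (auto simp: carrier_quotient)
    with \<open>g \<in> L\<close> show ?thesis
      by (simp add: quotient_action_coset linear LG stable lift closed equivariant)
  qed
  ultimately show ?thesis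
    unfolding isomorphic_representations_def
    using quotient_representation[OF rep L W stable] rep' by auto
qed

section \<open>Averaging over a character and coinvariants\<close>

context fd_representation
begin

lemma linear_action: "g \<in> carrier G \<Longrightarrow> complex_linear_map V V (\<rho> g)"
  by (intro complex_linear_mapI is_complex_vectorspace linear)

lemma action_closed [simp, intro]: "\<lbrakk>g \<in> carrier G; v \<in> carrier V\<rbrakk> \<Longrightarrow> \<rho> g v \<in> carrier V"
  by (rule complex_linear_map.map_closed[OF linear_action])

lemma action_add: "\<lbrakk>g \<in> carrier G; v \<in> carrier V; w \<in> carrier V\<rbrakk> \<Longrightarrow> \<rho> g (v \<oplus>\<^bsub>V\<^esub> w) = \<rho> g v \<oplus>\<^bsub>V\<^esub> \<rho> g w"
  by (rule complex_linear_map.map_add[OF linear_action])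

lemma action_scale: "\<lbrakk>g \<in> carrier G; v \<in> carrier V\<rbrakk> \<Longrightarrow> \<rho> g (c \<odot>\<^bsub>V\<^esub> v) = c \<odot>\<^bsub>V\<^esub> \<rho> g v"
  by (rule complex_linear_map.map_scale[OF linear_action])

lemma action_finsum:
  "\<lbrakk>g \<in> carrier G; f \<in> A \<rightarrow> carrier V\<rbrakk> \<Longrightarrow> \<rho> g (finsum V f A) = finsum V (\<lambda>x. \<rho> g (f x)) A"
  by (rule complex_linear_map.map_finsum[OF linear_action])

end

text \<open>
  The setting in which coinvariants are formed: a representation together with a finite subgroup
  and a character of it.
\<close>

locale twisted_representation = fd_representation G V \<pi>
  for G :: "('g, 'm) monoid_scheme" and V :: "(complex, 'v, 'n) module_scheme" and \<pi> +
  fixes U :: "'g set" and \<theta> :: "'g \<Rightarrow> complex"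
  assumes subgroup_U: "subgroup U G" and finite_U: "finite U"
    and character: "is_character (G\<lparr>carrier := U\<rparr>) \<theta>"
begin

lemma U_carrier [simp, intro]: "u \<in> U \<Longrightarrow> u \<in> carrier G"
  using subgroup.subset[OF subgroup_U] by auto

lemma character_mult: "\<lbrakk>u \<in> U; w \<in> U\<rbrakk> \<Longrightarrow> \<theta> (u \<otimes>\<^bsub>G\<^esub> w) = \<theta> u * \<theta> w"
  using character by (simp add: is_character_def hom_def units_of_def)

lemma character_nonzero [simp]: "u \<in> U \<Longrightarrow> \<theta> u \<noteq> 0"
  using character by (force simp: is_character_def hom_def units_of_def Units_def Pi_def)

lemma card_U_nonzero [simp]: "card U \<noteq> 0"
  using finite_U subgroup.one_closed[OF subgroup_U] by auto

definition average :: "'v \<Rightarrow> 'v"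
  where "average v = (1 / of_nat (card U)) \<odot>\<^bsub>V\<^esub> finsum V (\<lambda>u. (1 / \<theta> u) \<odot>\<^bsub>V\<^esub> \<pi> u v) U"

lemma average_closed [simp, intro]: "v \<in> carrier V \<Longrightarrow> average v \<in> carrier V"
  unfolding average_def by (intro scale_closed M.finsum_closed) auto

lemma average_hom: "average \<in> LinearCombinations.module_hom complex_field V V"
proof (rule module_homI)
  fix v w assume "v \<in> carrier V" "w \<in> carrier V"
  then have "finsum V (\<lambda>u. (1 / \<theta> u) \<odot>\<^bsub>V\<^esub> \<pi> u (v \<oplus>\<^bsub>V\<^esub> w)) U
      = finsum V (\<lambda>u. (1 / \<theta> u) \<odot>\<^bsub>V\<^esub> \<pi> u v) U \<oplus>\<^bsub>V\<^esub> finsum V (\<lambda>u. (1 / \<theta> u) \<odot>\<^bsub>V\<^esub> \<pi> u w) U"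
    by (simp add: action_add scale_add_right Pi_def cong: M.finsum_cong flip: M.finsum_addf)
  with \<open>v \<in> carrier V\<close> \<open>w \<in> carrier V\<close>
  show "average (v \<oplus>\<^bsub>V\<^esub> w) = average v \<oplus>\<^bsub>V\<^esub> average w"
    unfolding average_def by (auto intro!: scale_add_right M.finsum_closed)
next
  fix c v assume "v \<in> carrier V"
  then show "average (c \<odot>\<^bsub>V\<^esub> v) = c \<odot>\<^bsub>V\<^esub> average v"
    by (simp add: average_def action_scale scale_finsum Pi_def mult.commute mult.left_commute
        cong: M.finsum_cong)
qed auto

sublocale average: complex_linear_map V V average
  by (intro complex_linear_mapI is_complex_vectorspace average_hom)

text \<open>
  Substituting \<open>x\<^sup>-\<^sup>1u\<close> for \<open>u\<close> in the average; the next two lemmas substitute \<open>ux\<^sup>-\<^sup>1\<close> and a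
  conjugate of \<open>u\<close>.
\<close>

lemma average_eigen:
  assumes "x \<in> U" and "v \<in> carrier V"
  shows "\<pi> x (average v) = \<theta> x \<odot>\<^bsub>V\<^esub> average v"
proof -
  have bij: "bij_betw (\<lambda>u. x \<otimes>\<^bsub>G\<^esub> u) U U"
    using assms(1) subgroup_U finite_U
    by (intro bij_betw_imageI endo_inj_surj inj_onI) (auto simp: subgroup.m_closed)
  have "\<pi> x (finsum V (\<lambda>u. (1 / \<theta> u) \<odot>\<^bsub>V\<^esub> \<pi> u v) U)
      = finsum V (\<lambda>u. \<theta> x \<odot>\<^bsub>V\<^esub> ((1 / \<theta> (x \<otimes>\<^bsub>G\<^esub> u)) \<odot>\<^bsub>V\<^esub> \<pi> (x \<otimes>\<^bsub>G\<^esub> u) v)) U"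
    using assms by (simp add: action_finsum action_scale action_mult character_mult Pi_def
        cong: M.finsum_cong)
  also have "\<dots> = finsum V (\<lambda>u. \<theta> x \<odot>\<^bsub>V\<^esub> ((1 / \<theta> u) \<odot>\<^bsub>V\<^esub> \<pi> u v)) U"
    using assms by (intro finsum_reindex_bij[OF bij]) auto
  also have "\<dots> = \<theta> x \<odot>\<^bsub>V\<^esub> finsum V (\<lambda>u. (1 / \<theta> u) \<odot>\<^bsub>V\<^esub> \<pi> u v) U"
    using assms by (intro scale_finsum[symmetric]) auto
  finally show ?thesis
    using assms unfolding average_def
    by (subst action_scale) (auto intro!: M.finsum_closed simp: mult.commute)
qed

lemma average_translate:
  assumes "x \<in> U" and "v \<in> carrier V"
  shows "average (\<pi> x v) = \<theta> x \<odot>\<^bsub>V\<^esub> average v"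
proof -
  have bij: "bij_betw (\<lambda>u. u \<otimes>\<^bsub>G\<^esub> x) U U"
    using assms(1) subgroup_U finite_U
    by (intro bij_betw_imageI endo_inj_surj inj_onI) (auto simp: subgroup.m_closed)
  have "finsum V (\<lambda>u. (1 / \<theta> u) \<odot>\<^bsub>V\<^esub> \<pi> u (\<pi> x v)) U
      = finsum V (\<lambda>u. \<theta> x \<odot>\<^bsub>V\<^esub> ((1 / \<theta> (u \<otimes>\<^bsub>G\<^esub> x)) \<odot>\<^bsub>V\<^esub> \<pi> (u \<otimes>\<^bsub>G\<^esub> x) v)) U"
    using assms by (simp add: action_mult character_mult Pi_def cong: M.finsum_cong)
  also have "\<dots> = finsum V (\<lambda>u. \<theta> x \<odot>\<^bsub>V\<^esub> ((1 / \<theta> u) \<odot>\<^bsub>V\<^esub> \<pi> u v)) U"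
    using assms by (intro finsum_reindex_bij[OF bij]) auto
  also have "\<dots> = \<theta> x \<odot>\<^bsub>V\<^esub> finsum V (\<lambda>u. (1 / \<theta> u) \<odot>\<^bsub>V\<^esub> \<pi> u v) U"
    using assms by (intro scale_finsum[symmetric]) auto
  finally show ?thesis
    using assms unfolding average_def
    by (auto intro!: M.finsum_closed simp: mult.commute)
qed

lemma average_conjugate:
  assumes g: "g \<in> carrier G" and U: "\<And>u. u \<in> U \<Longrightarrow> g \<otimes>\<^bsub>G\<^esub> u \<otimes>\<^bsub>G\<^esub> inv\<^bsub>G\<^esub> g \<in> U"
    and \<theta>: "\<And>u. u \<in> U \<Longrightarrow> \<theta> (g \<otimes>\<^bsub>G\<^esub> u \<otimes>\<^bsub>G\<^esub> inv\<^bsub>G\<^esub> g) = \<theta> u" and v: "v \<in> carrier V"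
  shows "average (\<pi> g v) = \<pi> g (average v)"
proof -
  have bij: "bij_betw (\<lambda>u. g \<otimes>\<^bsub>G\<^esub> u \<otimes>\<^bsub>G\<^esub> inv\<^bsub>G\<^esub> g) U U"
    using g U finite_U by (intro bij_betw_imageI endo_inj_surj inj_onI) auto
  have move: "\<pi> (g \<otimes>\<^bsub>G\<^esub> u \<otimes>\<^bsub>G\<^esub> inv\<^bsub>G\<^esub> g) (\<pi> g v) = \<pi> g (\<pi> u v)" if "u \<in> U" for u
    using g v that by (simp add: mult_inv_cancel_right flip: action_mult)
  have "finsum V (\<lambda>u. (1 / \<theta> u) \<odot>\<^bsub>V\<^esub> \<pi> u (\<pi> g v)) U
      = finsum V (\<lambda>u. (1 / \<theta> (g \<otimes>\<^bsub>G\<^esub> u \<otimes>\<^bsub>G\<^esub> inv\<^bsub>G\<^esub> g))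
          \<odot>\<^bsub>V\<^esub> \<pi> (g \<otimes>\<^bsub>G\<^esub> u \<otimes>\<^bsub>G\<^esub> inv\<^bsub>G\<^esub> g) (\<pi> g v)) U"
    using g v by (intro finsum_reindex_bij[OF bij, symmetric]) auto
  also have "\<dots> = finsum V (\<lambda>u. (1 / \<theta> u) \<odot>\<^bsub>V\<^esub> \<pi> g (\<pi> u v)) U"
    using g v by (intro M.finsum_cong') (auto simp: move \<theta>)
  also have "\<dots> = \<pi> g (finsum V (\<lambda>u. (1 / \<theta> u) \<odot>\<^bsub>V\<^esub> \<pi> u v) U)"
    using g v by (simp add: action_finsum action_scale Pi_def cong: M.finsum_cong)
  finally show ?thesis
    using g v unfolding average_def
    by (subst action_scale) (auto intro!: M.finsum_closed)
qed

text \<open>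
  Under \<open>T\<close> all terms of the average become equal to \<open>T v\<close>. For the identity this says that
  eigenvectors are fixed by averaging; for the projection to the coinvariants it says that
  averaging does not change the class of a vector.
\<close>

lemma map_average:
  assumes T: "T \<in> LinearCombinations.module_hom complex_field V W" and W: "complex_vectorspace W"
    and v: "v \<in> carrier V" and eigen: "\<And>u. u \<in> U \<Longrightarrow> T (\<pi> u v) = \<theta> u \<odot>\<^bsub>W\<^esub> T v"
  shows "T (average v) = T v"
proof -
  interpret T: complex_linear_map V W T
    by (intro complex_linear_mapI is_complex_vectorspace T W)
  have "T (finsum V (\<lambda>u. (1 / \<theta> u) \<odot>\<^bsub>V\<^esub> \<pi> u v) U)
      = finsum W (\<lambda>u. T ((1 / \<theta> u) \<odot>\<^bsub>V\<^esub> \<pi> u v)) U"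
    using v by (intro T.map_finsum) auto
  also have "\<dots> = finsum W (\<lambda>u. if True then T v else \<zero>\<^bsub>W\<^esub>) U"
    using v by (intro T.W.M.finsum_cong') (auto simp: T.map_scale eigen)
  also have "\<dots> = of_nat (card U) \<odot>\<^bsub>W\<^esub> T v"
    using v finite_U by (subst T.W.finsum_indicator) auto
  finally show ?thesis
    using v unfolding average_def by (subst T.map_scale) (auto intro!: M.finsum_closed)
qed

lemma average_fixes_eigen:
  assumes "v \<in> carrier V" and "\<And>u. u \<in> U \<Longrightarrow> \<pi> u v = \<theta> u \<odot>\<^bsub>V\<^esub> v"
  shows "average v = v"
  using map_average[of "\<lambda>v. v" V v] assms
  by (auto intro!: module_homI is_complex_vectorspace)

abbreviation "K \<equiv> twisted_kernel V \<pi> U \<theta>"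

text \<open>
  Averaging kills the generators of \<open>K\<close> by \<open>average_translate\<close>. Conversely \<open>v\<close> and its average have
  the same class modulo \<open>K\<close>, since \<open>\<pi> u\<close> acts on classes as the scalar \<open>\<theta> u\<close>; so a vector with zero
  average lies in \<open>K\<close>.
\<close>

lemma twisted_kernel_eq: "K = {v \<in> carrier V. average v = \<zero>\<^bsub>V\<^esub>}"
proof (rule equalityI)
  let ?S = "{\<pi> u v \<ominus>\<^bsub>V\<^esub> \<theta> u \<odot>\<^bsub>V\<^esub> v | u v. u \<in> U \<and> v \<in> carrier V}"
  have S: "?S \<subseteq> carrier V" by auto
  have K: "subspace complex_field K V"
    unfolding twisted_kernel_def by (rule span_is_subspace[OF S])
  have "?S \<subseteq> {v \<in> carrier V. average v = \<zero>\<^bsub>V\<^esub>}"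
    by (auto simp: average.map_minus average.map_scale average_translate)
  then show "K \<subseteq> {v \<in> carrier V. average v = \<zero>\<^bsub>V\<^esub>}"
    unfolding twisted_kernel_def
    by (intro span_is_subset is_module average.kernel_subspace)
  interpret quotient V K
    by (intro quotient.intro quotient_axioms.intro is_complex_vectorspace K)
  show "{v \<in> carrier V. average v = \<zero>\<^bsub>V\<^esub>} \<subseteq> K"
  proof clarify
    fix v assume v: "v \<in> carrier V" "average v = \<zero>\<^bsub>V\<^esub>"
    have "K +>\<^bsub>V\<^esub> average v = K +>\<^bsub>V\<^esub> v"
    proof (rule map_average[OF coset_hom quotient_vectorspace v(1)])
      fix u assume "u \<in> U"
      with v have "\<pi> u v \<ominus>\<^bsub>V\<^esub> \<theta> u \<odot>\<^bsub>V\<^esub> v \<in> K"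
        unfolding twisted_kernel_def using in_own_span[OF S] by blast
      with \<open>u \<in> U\<close> v show "K +>\<^bsub>V\<^esub> \<pi> u v = \<theta> u \<odot>\<^bsub>Q\<^esub> (K +>\<^bsub>V\<^esub> v)"
        by (simp add: scale_quotient coset_eq_iff)
    qed
    with v have "K +>\<^bsub>V\<^esub> v = K" using a_subset by simp
    with a_rcos_self[OF v(1)] show "v \<in> K" by simp
  qed
qed

lemma twisted_kernel_subspace: "subspace complex_field K V"
  unfolding twisted_kernel_eq by (rule average.kernel_subspace)

lemma twisted_kernel_stable:
  assumes "g \<in> carrier G" and "\<And>u. u \<in> U \<Longrightarrow> g \<otimes>\<^bsub>G\<^esub> u \<otimes>\<^bsub>G\<^esub> inv\<^bsub>G\<^esub> g \<in> U"
    and "\<And>u. u \<in> U \<Longrightarrow> \<theta> (g \<otimes>\<^bsub>G\<^esub> u \<otimes>\<^bsub>G\<^esub> inv\<^bsub>G\<^esub> g) = \<theta> u"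
  shows "\<pi> g ` K \<subseteq> K"
  using assms complex_linear_map.map_zero[OF linear_action[OF assms(1)]]
  by (auto simp: twisted_kernel_eq average_conjugate)

end

section \<open>Induced representations\<close>

text \<open>
  The representation to be induced lives on the subgroup \<open>H\<close>; its facts carry the prefix \<open>H\<close>.
\<close>

locale induced_representation = group G + H: fd_representation "G\<lparr>carrier := H\<rparr>" V \<rho>
  for G :: "('g, 'm) monoid_scheme" and H :: "'g set"
    and V :: "(complex, 'v, 'n) module_scheme" and \<rho> :: "'g \<Rightarrow> 'v \<Rightarrow> 'v" +
  assumes finite_group: "finite (carrier G)" and subgroup_H: "subgroup H G"
begin

abbreviation "I \<equiv> induced_space G H V \<rho>"

lemma H_carrier [simp, intro]: "h \<in> H \<Longrightarrow> h \<in> carrier G"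
  using subgroup.subset[OF subgroup_H] by auto

lemma H_action_closed [simp, intro]: "\<lbrakk>h \<in> H; v \<in> carrier V\<rbrakk> \<Longrightarrow> \<rho> h v \<in> carrier V"
  using H.action_closed[of h v] by simp

lemma H_linear: "h \<in> H \<Longrightarrow> complex_linear_map V V (\<rho> h)"
  using H.linear_action[of h] by simp

lemma induced_carrier_iff:
  "f \<in> carrier I \<longleftrightarrow> f \<in> carrier G \<rightarrow>\<^sub>E carrier V \<and>
    (\<forall>h \<in> H. \<forall>g \<in> carrier G. f (h \<otimes>\<^bsub>G\<^esub> g) = \<rho> h (f g))"
  by (simp add: induced_space_def)

lemma induced_closed [simp, intro]: "\<lbrakk>f \<in> carrier I; g \<in> carrier G\<rbrakk> \<Longrightarrow> f g \<in> carrier V"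
  by (auto simp: induced_carrier_iff)

lemma induced_left: "\<lbrakk>f \<in> carrier I; h \<in> H; g \<in> carrier G\<rbrakk> \<Longrightarrow> f (h \<otimes>\<^bsub>G\<^esub> g) = \<rho> h (f g)"
  by (auto simp: induced_carrier_iff)

lemma induced_eqI:
  "\<lbrakk>f \<in> carrier I; f' \<in> carrier I; \<And>g. g \<in> carrier G \<Longrightarrow> f g = f' g\<rbrakk> \<Longrightarrow> f = f'"
  by (auto simp: induced_carrier_iff intro: PiE_ext)

lemma restrict_inducedI:
  assumes "\<And>g. g \<in> carrier G \<Longrightarrow> f g \<in> carrier V"
    and "\<And>h g. \<lbrakk>h \<in> H; g \<in> carrier G\<rbrakk> \<Longrightarrow> f (h \<otimes>\<^bsub>G\<^esub> g) = \<rho> h (f g)"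
  shows "restrict f (carrier G) \<in> carrier I"
  using assms by (auto simp: induced_carrier_iff)

lemma induced_zero_apply: "g \<in> carrier G \<Longrightarrow> \<zero>\<^bsub>I\<^esub> g = \<zero>\<^bsub>V\<^esub>"
  and induced_add_apply: "g \<in> carrier G \<Longrightarrow> (f \<oplus>\<^bsub>I\<^esub> f') g = f g \<oplus>\<^bsub>V\<^esub> f' g"
  and induced_scale_apply: "g \<in> carrier G \<Longrightarrow> (c \<odot>\<^bsub>I\<^esub> f) g = c \<odot>\<^bsub>V\<^esub> f g"
  by (simp_all add: induced_space_def)

lemmas induced_apply = induced_zero_apply induced_add_apply induced_scale_apply

lemma induced_zero_closed: "\<zero>\<^bsub>I\<^esub> \<in> carrier I"
  using restrict_inducedI[of "\<lambda>_. \<zero>\<^bsub>V\<^esub>"] complex_linear_map.map_zero[OF H_linear]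
  by (simp add: induced_space_def)

lemma induced_add_closed: "\<lbrakk>f \<in> carrier I; f' \<in> carrier I\<rbrakk> \<Longrightarrow> f \<oplus>\<^bsub>I\<^esub> f' \<in> carrier I"
  using restrict_inducedI[of "\<lambda>g. f g \<oplus>\<^bsub>V\<^esub> f' g"] complex_linear_map.map_add[OF H_linear]
  by (simp add: induced_left) (simp add: induced_space_def)

lemma induced_scale_closed: "f \<in> carrier I \<Longrightarrow> c \<odot>\<^bsub>I\<^esub> f \<in> carrier I"
  using restrict_inducedI[of "\<lambda>g. c \<odot>\<^bsub>V\<^esub> f g"] complex_linear_map.map_scale[OF H_linear]
  by (simp add: induced_left) (simp add: induced_space_def)

lemma induced_vectorspace: "complex_vectorspace I"
  by (rule complex_vectorspaceI; (intro induced_eqI)?)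
    (simp_all add: induced_zero_closed induced_add_closed induced_scale_closed induced_apply
      H.scale_add_left H.scale_add_right H.M.add.m_ac H.M.r_neg H.scale_minus_one)

sublocale I: complex_vectorspace I
  by (rule induced_vectorspace)

lemma evaluation_hom: "g \<in> carrier G \<Longrightarrow> (\<lambda>f. f g) \<in> LinearCombinations.module_hom complex_field I V"
  by (rule module_homI) (simp_all add: induced_apply)

text \<open>
  The function in the induced space that takes the value \<open>v\<close> at \<open>x\<close> and is supported on the coset
  \<open>Hx\<close>. These functions generate the induced space.
\<close>

definition bump :: "'g \<Rightarrow> 'v \<Rightarrow> 'g \<Rightarrow> 'v"
  where "bump x v = (\<lambda>g \<in> carrier G. if g \<otimes>\<^bsub>G\<^esub> inv\<^bsub>G\<^esub> x \<in> H then \<rho> (g \<otimes>\<^bsub>G\<^esub> inv\<^bsub>G\<^esub> x) v else \<zero>\<^bsub>V\<^esub>)"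

lemma bump_apply:
  "g \<in> carrier G \<Longrightarrow>
    bump x v g = (if g \<otimes>\<^bsub>G\<^esub> inv\<^bsub>G\<^esub> x \<in> H then \<rho> (g \<otimes>\<^bsub>G\<^esub> inv\<^bsub>G\<^esub> x) v else \<zero>\<^bsub>V\<^esub>)"
  by (simp add: bump_def)

lemma bump_closed:
  assumes x: "x \<in> carrier G" and v: "v \<in> carrier V"
  shows "bump x v \<in> carrier I"
  unfolding bump_def
proof (rule restrict_inducedI)
  fix h g assume h: "h \<in> H" and g: "g \<in> carrier G"
  let ?k = "g \<otimes>\<^bsub>G\<^esub> inv\<^bsub>G\<^esub> x"
  have assoc: "h \<otimes>\<^bsub>G\<^esub> g \<otimes>\<^bsub>G\<^esub> inv\<^bsub>G\<^esub> x = h \<otimes>\<^bsub>G\<^esub> ?k"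
    using h g x by (simp add: m_assoc)
  have "h \<otimes>\<^bsub>G\<^esub> ?k \<in> H \<longleftrightarrow> ?k \<in> H"
    using h g x subgroup_H by (simp add: subgroup.m_closed subgroup_mem_cancel)
  then show "(if h \<otimes>\<^bsub>G\<^esub> g \<otimes>\<^bsub>G\<^esub> inv\<^bsub>G\<^esub> x \<in> H then \<rho> (h \<otimes>\<^bsub>G\<^esub> g \<otimes>\<^bsub>G\<^esub> inv\<^bsub>G\<^esub> x) v else \<zero>\<^bsub>V\<^esub>)
      = \<rho> h (if ?k \<in> H then \<rho> ?k v else \<zero>\<^bsub>V\<^esub>)"
    using h v H.action_mult[of h ?k v] complex_linear_map.map_zero[OF H_linear[OF h]]
    by (simp add: assoc)
qed (use x v in auto)

lemma bump_hom:
  assumes x: "x \<in> carrier G"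
  shows "bump x \<in> LinearCombinations.module_hom complex_field V I"
proof (rule module_homI)
  fix v w assume "v \<in> carrier V" "w \<in> carrier V"
  with x show "bump x (v \<oplus>\<^bsub>V\<^esub> w) = bump x v \<oplus>\<^bsub>I\<^esub> bump x w"
    by (intro induced_eqI)
      (auto simp: bump_closed induced_add_closed induced_apply bump_apply
        complex_linear_map.map_add[OF H_linear])
next
  fix c v assume "v \<in> carrier V"
  with x show "bump x (c \<odot>\<^bsub>V\<^esub> v) = c \<odot>\<^bsub>I\<^esub> bump x v"
    by (intro induced_eqI)
      (auto simp: bump_closed induced_scale_closed induced_apply bump_apply
        complex_linear_map.map_scale[OF H_linear])
qed (use x in \<open>rule bump_closed\<close>)

lemma card_translates:
  assumes g: "g \<in> carrier G"
  shows "card {x \<in> carrier G. g \<otimes>\<^bsub>G\<^esub> inv\<^bsub>G\<^esub> x \<in> H} = card H"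
proof (rule bij_betw_same_card)
  show "bij_betw (\<lambda>x. g \<otimes>\<^bsub>G\<^esub> inv\<^bsub>G\<^esub> x) {x \<in> carrier G. g \<otimes>\<^bsub>G\<^esub> inv\<^bsub>G\<^esub> x \<in> H} H"
    by (rule bij_betw_byWitness[where f' = "\<lambda>h. inv\<^bsub>G\<^esub> h \<otimes>\<^bsub>G\<^esub> g"])
      (use g in \<open>auto simp: inv_mult_group mult_inv_cancel_right m_assoc[symmetric]\<close>)
qed

text \<open>
  At \<open>g\<close> the terms with \<open>x \<in> Hg\<close> all equal \<open>f g\<close> up to the factor, by equivariance of \<open>f\<close>, and the
  others vanish. Summing over all of \<open>G\<close> rather than over coset representatives hits each value
  \<open>|H|\<close> times, whence the factor.
\<close>

lemma sum_of_bumps: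
  assumes f: "f \<in> carrier I"
  shows "f = finsum I (\<lambda>x. bump x ((1 / of_nat (card H)) \<odot>\<^bsub>V\<^esub> f x)) (carrier G)"
proof (rule induced_eqI)
  let ?c = "1 / of_nat (card H)"
  fix g assume g: "g \<in> carrier G"
  interpret E: complex_linear_map I V "\<lambda>f. f g"
    by (intro complex_linear_mapI induced_vectorspace H.is_complex_vectorspace evaluation_hom g)
  have H: "card H \<noteq> 0"
    using finite_subset[OF subgroup.subset[OF subgroup_H] finite_group]
      subgroup.one_closed[OF subgroup_H] by auto
  have "finsum I (\<lambda>x. bump x (?c \<odot>\<^bsub>V\<^esub> f x)) (carrier G) g
      = finsum V (\<lambda>x. bump x (?c \<odot>\<^bsub>V\<^esub> f x) g) (carrier G)"
    using f by (intro E.map_finsum) (auto intro: bump_closed)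
  also have "\<dots> = finsum V
      (\<lambda>x. if g \<otimes>\<^bsub>G\<^esub> inv\<^bsub>G\<^esub> x \<in> H then ?c \<odot>\<^bsub>V\<^esub> f g else \<zero>\<^bsub>V\<^esub>) (carrier G)"
  proof (rule H.M.finsum_cong')
    fix x assume x: "x \<in> carrier G"
    have "\<rho> (g \<otimes>\<^bsub>G\<^esub> inv\<^bsub>G\<^esub> x) (?c \<odot>\<^bsub>V\<^esub> f x) = ?c \<odot>\<^bsub>V\<^esub> f g" if k: "g \<otimes>\<^bsub>G\<^esub> inv\<^bsub>G\<^esub> x \<in> H"
    proof -
      have "\<rho> (g \<otimes>\<^bsub>G\<^esub> inv\<^bsub>G\<^esub> x) (f x) = f (g \<otimes>\<^bsub>G\<^esub> inv\<^bsub>G\<^esub> x \<otimes>\<^bsub>G\<^esub> x)"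
        using f k x by (simp add: induced_left)
      also have "g \<otimes>\<^bsub>G\<^esub> inv\<^bsub>G\<^esub> x \<otimes>\<^bsub>G\<^esub> x = g"
        using g x by (rule mult_inv_cancel_right)
      finally show ?thesis
        using f x by (simp add: complex_linear_map.map_scale[OF H_linear[OF k]])
    qed
    with g show "bump x (?c \<odot>\<^bsub>V\<^esub> f x) g
        = (if g \<otimes>\<^bsub>G\<^esub> inv\<^bsub>G\<^esub> x \<in> H then ?c \<odot>\<^bsub>V\<^esub> f g else \<zero>\<^bsub>V\<^esub>)"
      by (simp add: bump_apply)
  qed (use f g in auto)
  also have "\<dots> = of_nat (card H) \<odot>\<^bsub>V\<^esub> (?c \<odot>\<^bsub>V\<^esub> f g)"
    using f g finite_group by (subst H.finsum_indicator) (auto simp: card_translates)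
  also have "\<dots> = f g"
    using f g H by simp
  finally show "f g = finsum I (\<lambda>x. bump x (?c \<odot>\<^bsub>V\<^esub> f x)) (carrier G) g" ..
qed (use f in \<open>auto intro!: I.M.finsum_closed bump_closed\<close>)

lemma induced_fin_dim: "I.fin_dim"
proof (rule fin_dim_of_finite_sum_of_images[OF H.is_complex_vectorspace induced_vectorspace
      finite_group bump_hom H.finite_dimensional])
  fix f assume f: "f \<in> carrier I"
  then show "\<exists>v \<in> carrier G \<rightarrow> carrier V. f = finsum I (\<lambda>x. bump x (v x)) (carrier G)"
    by (intro bexI[where x = "\<lambda>x. (1 / of_nat (card H)) \<odot>\<^bsub>V\<^esub> f x"] sum_of_bumps) auto
qed

lemma induced_action_apply: "g \<in> carrier G \<Longrightarrow> induced_action G x f g = f (g \<otimes>\<^bsub>G\<^esub> x)"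
  by (simp add: induced_action_def)

lemma induced_action_closed:
  assumes "x \<in> carrier G" and "f \<in> carrier I"
  shows "induced_action G x f \<in> carrier I"
  unfolding induced_action_def using assms
  by (intro restrict_inducedI) (auto simp: m_assoc induced_left)

lemma fd_representation_induced: "fd_representation G I (induced_action G)"
proof (intro fd_representation.intro fd_representation_axioms.intro)
  fix x assume x: "x \<in> carrier G"
  show "induced_action G x \<in> LinearCombinations.module_hom complex_field I I"
  proof (rule module_homI)
    fix f f' assume "f \<in> carrier I" "f' \<in> carrier I"
    with x show "induced_action G x (f \<oplus>\<^bsub>I\<^esub> f') = induced_action G x f \<oplus>\<^bsub>I\<^esub> induced_action G x f'"
      by (intro induced_eqI)
        (auto simp: induced_action_closed induced_add_closed induced_apply induced_action_apply)
  next
    fix c f assume "f \<in> carrier I"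
    with x show "induced_action G x (c \<odot>\<^bsub>I\<^esub> f) = c \<odot>\<^bsub>I\<^esub> induced_action G x f"
      by (intro induced_eqI)
        (auto simp: induced_action_closed induced_scale_closed induced_apply induced_action_apply)
  qed (use x in \<open>rule induced_action_closed\<close>)
next
  fix f assume "f \<in> carrier I"
  then show "induced_action G \<one>\<^bsub>G\<^esub> f = f"
    by (intro induced_eqI) (auto simp: induced_action_closed induced_action_apply)
next
  fix x y f assume "x \<in> carrier G" "y \<in> carrier G" "f \<in> carrier I"
  then show "induced_action G (x \<otimes>\<^bsub>G\<^esub> y) f = induced_action G x (induced_action G y f)"
    by (intro induced_eqI) (auto simp: induced_action_closed induced_action_apply m_assoc)
qed (unfold_locales, rule induced_fin_dim)

end

section \<open>Coinvariants of an induced representation\<close>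

text \<open>
  All groups are subgroups of one ambient group, and normalization is closure under conjugation.
  The character of \<open>U\<^sub>0\<close> is always the restriction of \<open>\<theta>\<close>.
\<close>

locale induced_coinvariants = group G0
  for G0 :: "('g, 'm) monoid_scheme" (structure) +
  fixes G U H U0 :: "'g set" and \<theta> :: "'g \<Rightarrow> complex"
    and V :: "(complex, 'v, 'n) module_scheme" and \<rho> :: "'g \<Rightarrow> 'v \<Rightarrow> 'v"
  assumes finite_G0: "finite (carrier G0)"
    and sub: "subgroup G G0" "subgroup U G0" "subgroup H G0" "subgroup U0 G0"
    and H_G: "H \<subseteq> G" and U0_U: "U0 \<subseteq> U"
    and char: "is_character (G0\<lparr>carrier := U\<rparr>) \<theta>"
    and conj_U: "\<lbrakk>g \<in> G; u \<in> U\<rbrakk> \<Longrightarrow> g \<otimes> u \<otimes> inv g \<in> U"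
    and conj_\<theta>: "\<lbrakk>g \<in> G; u \<in> U\<rbrakk> \<Longrightarrow> \<theta> (g \<otimes> u \<otimes> inv g) = \<theta> u"
    and conj_U0: "\<lbrakk>h \<in> H; u \<in> U0\<rbrakk> \<Longrightarrow> h \<otimes> u \<otimes> inv h \<in> U0"
    and intersection: "G \<inter> U \<subseteq> H \<inter> U0"
    and rep: "fd_representation (G0\<lparr>carrier := H <#> U0\<rparr>) V \<rho>"
begin

abbreviation "GU \<equiv> G0\<lparr>carrier := G <#> U\<rparr>"
abbreviation "HU0 \<equiv> G0\<lparr>carrier := H <#> U0\<rparr>"

lemma elements [simp]:
  "g \<in> G \<Longrightarrow> g \<in> carrier G0" "u \<in> U \<Longrightarrow> u \<in> carrier G0"
  "h \<in> H \<Longrightarrow> h \<in> G" "u \<in> U0 \<Longrightarrow> u \<in> U"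
  using sub[THEN subgroup.subset] H_G U0_U by auto

lemma closed [simp]:
  "\<one> \<in> G" "\<one> \<in> U" "\<one> \<in> H" "\<one> \<in> U0"
  "\<lbrakk>g \<in> G; g' \<in> G\<rbrakk> \<Longrightarrow> g \<otimes> g' \<in> G" "\<lbrakk>u \<in> U; u' \<in> U\<rbrakk> \<Longrightarrow> u \<otimes> u' \<in> U"
  "g \<in> G \<Longrightarrow> inv g \<in> G" "u \<in> U \<Longrightarrow> inv u \<in> U"
  using sub by (auto simp: subgroup.one_closed subgroup.m_closed subgroup.m_inv_closed)

lemma subgroup_GU: "subgroup (G <#> U) G0"
  using sub conj_U by (intro subgroup_normalized_product)

lemma subgroup_HU0: "subgroup (H <#> U0) G0"
  using sub conj_U0 by (intro subgroup_normalized_product)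

lemma product_memI: "\<lbrakk>g \<in> G; u \<in> U\<rbrakk> \<Longrightarrow> g \<otimes> u \<in> G <#> U"
  by (auto simp: set_mult_def)

lemma product_memE:
  assumes "y \<in> G <#> U"
  obtains g u where "g \<in> G" "u \<in> U" "y = g \<otimes> u"
  using assms by (auto simp: set_mult_def)

lemma subsets_GU: "G \<subseteq> G <#> U" "U \<subseteq> G <#> U" "H <#> U0 \<subseteq> G <#> U"
  using product_memI[of _ \<one>] product_memI[of \<one>] by (auto simp: set_mult_def intro!: bexI)

lemma subsets_HU0: "H \<subseteq> H <#> U0" "U0 \<subseteq> H <#> U0"
proof -
  have "h \<otimes> u \<in> H <#> U0" if "h \<in> H" "u \<in> U0" for h u
    using that by (auto simp: set_mult_def)
  from this[of _ \<one>] this[of \<one>] show "H \<subseteq> H <#> U0" "U0 \<subseteq> H <#> U0" by auto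
qed

lemma subgroups_GU: "subgroup G GU" "subgroup U GU" "subgroup (H <#> U0) GU"
  using subsets_GU sub subgroup_GU subgroup_HU0 by (auto intro: subgroup_incl)

lemma subgroups_HU0: "subgroup H HU0" "subgroup U0 HU0"
  using subsets_HU0 sub subgroup_HU0 by (auto intro: subgroup_incl)

lemma finite_subset_G0: "subgroup A G0 \<Longrightarrow> finite A"
  using finite_subset[OF subgroup.subset finite_G0] .

lemma inv_GU: "x \<in> G <#> U \<Longrightarrow> inv\<^bsub>GU\<^esub> x = inv x"
  and inv_HU0: "x \<in> H <#> U0 \<Longrightarrow> inv\<^bsub>HU0\<^esub> x = inv x"
  by (simp_all add: subgroup_GU subgroup_HU0)

lemma induced_representation_GU: "induced_representation GU (H <#> U0) V \<rho>"
  using rep subgroup.subgroup_is_group[OF subgroup_GU is_group] finite_subset_G0[OF subgroup_GU]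
    subgroups_GU(3)
  by (simp add: induced_representation_def induced_representation_axioms_def)

text \<open>
  Prefixes: \<open>I\<close> is the representation induced to \<open>GU\<close>, \<open>L\<close> its averaging over \<open>U\<close>; \<open>R\<close> is the
  averaging of \<open>V\<close> over \<open>U\<^sub>0\<close>, \<open>C\<close> the quotient of \<open>V\<close> formed from it, and \<open>J\<close> the representation
  induced from the latter.
\<close>

sublocale I: induced_representation GU "H <#> U0" V \<rho>
  by (rule induced_representation_GU)

sublocale L: twisted_representation GU I.I "induced_action GU" U \<theta>
  using I.fd_representation_induced subgroups_GU(2) finite_subset_G0[OF sub(2)] char
  by (simp add: twisted_representation_def twisted_representation_axioms_def)

sublocale R: twisted_representation HU0 V \<rho> U0 "restrict \<theta> U0"
proof -
  have "is_character (G0\<lparr>carrier := U0\<rparr>) (restrict \<theta> U0)"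
    using char subgroup.m_closed[OF sub(4)] U0_U by (auto simp: is_character_def hom_def)
  then show "twisted_representation HU0 V \<rho> U0 (restrict \<theta> U0)"
    using rep subgroups_HU0(2) finite_subset_G0[OF sub(4)]
    by (simp add: twisted_representation_def twisted_representation_axioms_def)
qed

sublocale C: quotient V R.K
  by (intro quotient.intro quotient_axioms.intro I.H.is_complex_vectorspace R.twisted_kernel_subspace)

abbreviation "\<rho>\<^sub>C \<equiv> coinvariant_action V \<rho> U0 (restrict \<theta> U0)"

lemma coinvariant_representation: "fd_representation (G0\<lparr>carrier := H\<rparr>) C.Q \<rho>\<^sub>C"
  and coinvariant_action_coset:
    "\<lbrakk>h \<in> H; v \<in> carrier V\<rbrakk> \<Longrightarrow> \<rho>\<^sub>C h (R.K +>\<^bsub>V\<^esub> v) = R.K +>\<^bsub>V\<^esub> \<rho> h v"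
  and R_average_H: "\<lbrakk>h \<in> H; v \<in> carrier V\<rbrakk> \<Longrightarrow> R.average (\<rho> h v) = \<rho> h (R.average v)"
proof -
  have HU0: "h \<in> H <#> U0" if "h \<in> H" for h
    using that subsets_HU0 by auto
  have conj: "h \<otimes>\<^bsub>HU0\<^esub> u \<otimes>\<^bsub>HU0\<^esub> inv\<^bsub>HU0\<^esub> h \<in> U0"
    "restrict \<theta> U0 (h \<otimes>\<^bsub>HU0\<^esub> u \<otimes>\<^bsub>HU0\<^esub> inv\<^bsub>HU0\<^esub> h) = restrict \<theta> U0 u"
    if "h \<in> H" "u \<in> U0" for h u
    using that by (simp_all add: inv_HU0 HU0 conj_U0 conj_\<theta>)
  have stable: "\<rho> h ` R.K \<subseteq> R.K" if "h \<in> H" for h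
    using that by (intro R.twisted_kernel_stable conj) (simp_all add: HU0)
  show "fd_representation (G0\<lparr>carrier := H\<rparr>) C.Q \<rho>\<^sub>C"
    using quotient_representation[OF rep subgroups_HU0(1) R.twisted_kernel_subspace stable]
    by (simp add: coinvariant_action_def)
  show "\<rho>\<^sub>C h (R.K +>\<^bsub>V\<^esub> v) = R.K +>\<^bsub>V\<^esub> \<rho> h v" if "h \<in> H" "v \<in> carrier V"
    using that HU0 unfolding coinvariant_action_def
    by (intro C.quotient_action_coset fd_representation.linear[OF rep] stable) simp_all
  show "R.average (\<rho> h v) = \<rho> h (R.average v)" if "h \<in> H" "v \<in> carrier V"
    using that HU0 by (intro R.average_conjugate conj) simp_all
qed

sublocale J: induced_representation "G0\<lparr>carrier := G\<rparr>" H C.Q \<rho>\<^sub>C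
  using coinvariant_representation subgroup.subgroup_is_group[OF sub(1) is_group]
    finite_subset_G0[OF sub(1)] subgroup_incl[OF sub(3,1) H_G]
  by (simp add: induced_representation_def induced_representation_axioms_def)

definition eigenfunctions :: "('g \<Rightarrow> 'v) set"
  where "eigenfunctions =
    {f \<in> carrier I.I. \<forall>x \<in> G <#> U. \<forall>u \<in> U. f (x \<otimes> u) = \<theta> u \<odot>\<^bsub>V\<^esub> f x}"

lemma average_eigenfunction:
  assumes "f \<in> carrier I.I"
  shows "L.average f \<in> eigenfunctions"
proof -
  have "L.average f (x \<otimes> u) = \<theta> u \<odot>\<^bsub>V\<^esub> L.average f x" if "x \<in> G <#> U" "u \<in> U" for x u
  proof -
    have "L.average f (x \<otimes> u) = induced_action GU u (L.average f) x"
      using that by (simp add: induced_action_def)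
    also have "\<dots> = (\<theta> u \<odot>\<^bsub>I.I\<^esub> L.average f) x"
      using that assms by (simp add: L.average_eigen)
    finally show ?thesis using that by (simp add: I.induced_scale_apply)
  qed
  with assms show ?thesis by (auto simp: eigenfunctions_def)
qed

lemma average_of_eigenfunction:
  assumes "f \<in> eigenfunctions"
  shows "L.average f = f"
proof (rule L.average_fixes_eigen)
  show f: "f \<in> carrier I.I" using assms by (simp add: eigenfunctions_def)
  fix u assume u: "u \<in> U"
  with f assms subsets_GU show "induced_action GU u f = \<theta> u \<odot>\<^bsub>I.I\<^esub> f"
    by (intro I.induced_eqI I.induced_action_closed I.induced_scale_closed)
      (auto simp: I.induced_action_apply I.induced_scale_apply eigenfunctions_def)
qed

text \<open>
  Left translation by \<open>u \<in> U\<^sub>0\<close> at \<open>g\<close> is right translation by \<open>g\<^sup>-\<^sup>1ug \<in> U\<close>, on which \<open>\<theta>\<close> takes the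
  value \<open>\<theta> u\<close>. Hence the values on \<open>G\<close> are eigenvectors of \<open>U\<^sub>0\<close>.
\<close>

lemma eigenfunction_value:
  assumes f: "f \<in> eigenfunctions" and g: "g \<in> G"
  shows "R.average (f g) = f g"
proof (rule R.average_fixes_eigen)
  have GU: "g \<in> G <#> U" using g subsets_GU by auto
  have I: "f \<in> carrier I.I" using f by (simp add: eigenfunctions_def)
  show "f g \<in> carrier V" using I GU by simp
  fix u assume u: "u \<in> U0"
  then have HU0: "u \<in> H <#> U0" using subsets_HU0 by auto
  have conj: "inv g \<otimes> u \<otimes> g \<in> U" "\<theta> (inv g \<otimes> u \<otimes> g) = \<theta> u"
    using conj_U[of "inv g" u] conj_\<theta>[of "inv g" u] g u by simp_all
  have "\<rho> u (f g) = f (u \<otimes> g)"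
    using I.induced_left[OF I HU0, of g] GU by simp
  also have "u \<otimes> g = g \<otimes> (inv g \<otimes> u \<otimes> g)"
    using g u by (simp add: m_assoc mult_inv_cancel_left)
  also have "f \<dots> = \<theta> u \<odot>\<^bsub>V\<^esub> f g"
    using f GU conj by (simp add: eigenfunctions_def)
  finally show "\<rho> u (f g) = restrict \<theta> U0 u \<odot>\<^bsub>V\<^esub> f g" using u by simp
qed

lemma eigenfunction_eqI:
  assumes f: "f \<in> eigenfunctions" and f': "f' \<in> eigenfunctions"
    and eq: "\<And>g. g \<in> G \<Longrightarrow> f g = f' g"
  shows "f = f'"
proof (rule I.induced_eqI)
  show "f \<in> carrier I.I" "f' \<in> carrier I.I" using f f' by (simp_all add: eigenfunctions_def)
  fix y assume "y \<in> carrier GU"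
  then obtain g u where gu: "g \<in> G" "u \<in> U" "y = g \<otimes> u" by (auto elim: product_memE)
  moreover from gu have "g \<in> G <#> U" using subsets_GU by auto
  ultimately show "f y = f' y" using f f' eq by (simp add: eigenfunctions_def)
qed

text \<open>
  The map that induces the isomorphism. Averaging first makes it vanish on the twisted kernel.
\<close>

definition comparison :: "('g \<Rightarrow> 'v) \<Rightarrow> 'g \<Rightarrow> 'v set"
  where "comparison f = (\<lambda>g \<in> G. R.K +>\<^bsub>V\<^esub> L.average f g)"

lemma comparison_apply: "g \<in> G \<Longrightarrow> comparison f g = R.K +>\<^bsub>V\<^esub> L.average f g"
  by (simp add: comparison_def)

lemma average_value [simp]: "\<lbrakk>f \<in> carrier I.I; g \<in> G\<rbrakk> \<Longrightarrow> L.average f g \<in> carrier V"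
  using I.induced_closed[OF L.average_closed, of f g] subsets_GU by auto

lemma comparison_closed:
  assumes f: "f \<in> carrier I.I"
  shows "comparison f \<in> carrier J.I"
proof -
  have "restrict (\<lambda>g. R.K +>\<^bsub>V\<^esub> L.average f g) (carrier (G0\<lparr>carrier := G\<rparr>)) \<in> carrier J.I"
  proof (rule J.restrict_inducedI)
    fix h g assume "h \<in> H" and "g \<in> carrier (G0\<lparr>carrier := G\<rparr>)"
    then have h: "h \<in> H" "h \<in> H <#> U0" and g: "g \<in> G" "g \<in> G <#> U"
      using subsets_GU subsets_HU0 by auto
    have "L.average f (h \<otimes> g) = \<rho> h (L.average f g)"
      using I.induced_left[OF L.average_closed[OF f] h(2), of g] g by simp
    with f h g show "R.K +>\<^bsub>V\<^esub> L.average f (h \<otimes>\<^bsub>G0\<lparr>carrier := G\<rparr>\<^esub> g)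
        = \<rho>\<^sub>C h (R.K +>\<^bsub>V\<^esub> L.average f g)"
      by (simp add: coinvariant_action_coset)
  qed (use f in \<open>simp add: C.carrier_quotient\<close>)
  then show ?thesis by (simp add: comparison_def)
qed

lemma comparison_hom: "comparison \<in> LinearCombinations.module_hom complex_field I.I J.I"
proof (rule module_homI)
  have GU: "g \<in> G <#> U" if "g \<in> G" for g using that subsets_GU by auto
  fix f f' assume "f \<in> carrier I.I" "f' \<in> carrier I.I"
  then show "comparison (f \<oplus>\<^bsub>I.I\<^esub> f') = comparison f \<oplus>\<^bsub>J.I\<^esub> comparison f'"
    by (intro J.induced_eqI)
      (simp_all add: comparison_closed I.induced_add_closed J.induced_add_closed J.induced_add_apply
        I.induced_add_apply comparison_apply L.average.map_add C.add_quotient GU)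
next
  have GU: "g \<in> G <#> U" if "g \<in> G" for g using that subsets_GU by auto
  fix c f assume "f \<in> carrier I.I"
  then show "comparison (c \<odot>\<^bsub>I.I\<^esub> f) = c \<odot>\<^bsub>J.I\<^esub> comparison f"
    by (intro J.induced_eqI)
      (simp_all add: comparison_closed I.induced_scale_closed J.induced_scale_closed
        J.induced_scale_apply I.induced_scale_apply comparison_apply L.average.map_scale
        C.scale_quotient GU)
qed (rule comparison_closed)

text \<open>
  If all classes vanish, the values of the averaged function on \<open>G\<close> are eigenvectors of \<open>U\<^sub>0\<close> with
  trivial class, hence zero; and an eigenfunction that vanishes on \<open>G\<close> vanishes on \<open>GU\<close>.
\<close>

lemma comparison_kernel:
  assumes f: "f \<in> carrier I.I"
  shows "comparison f = \<zero>\<^bsub>J.I\<^esub> \<longleftrightarrow> f \<in> L.K"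
proof
  assume zero: "comparison f = \<zero>\<^bsub>J.I\<^esub>"
  have "L.average f = \<zero>\<^bsub>I.I\<^esub>"
  proof (rule eigenfunction_eqI)
    show "L.average f \<in> eigenfunctions" using f by (rule average_eigenfunction)
    show "\<zero>\<^bsub>I.I\<^esub> \<in> eigenfunctions"
      using average_eigenfunction[of "\<zero>\<^bsub>I.I\<^esub>"] by simp
    fix g assume g: "g \<in> G"
    have "R.K +>\<^bsub>V\<^esub> L.average f g = R.K +>\<^bsub>V\<^esub> \<zero>\<^bsub>V\<^esub>"
      using comparison_apply[OF g, of f] g by (simp add: zero J.induced_zero_apply C.zero_quotient)
    then have "L.average f g \<in> R.K"
      using C.a_rcos_self[of "L.average f g"] f g C.a_subset by simp
    then have "R.average (L.average f g) = \<zero>\<^bsub>V\<^esub>"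
      using R.twisted_kernel_eq by blast
    then show "L.average f g = \<zero>\<^bsub>I.I\<^esub> g"
      using eigenfunction_value[OF average_eigenfunction[OF f] g] g subsets_GU
      by (auto simp: I.induced_zero_apply)
  qed
  with f show "f \<in> L.K" by (simp add: L.twisted_kernel_eq)
next
  assume "f \<in> L.K"
  then have "L.average f = \<zero>\<^bsub>I.I\<^esub>" by (simp add: L.twisted_kernel_eq)
  moreover have "g \<in> G <#> U" if "g \<in> G" for g using that subsets_GU by auto
  ultimately show "comparison f = \<zero>\<^bsub>J.I\<^esub>"
    using f by (intro J.induced_eqI)
      (simp_all add: comparison_closed J.induced_zero_closed J.induced_zero_apply comparison_apply
        C.zero_quotient I.induced_zero_apply)
qed

lemma conj_GU:
  assumes "g \<in> G" and "u \<in> U"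
  shows "g \<otimes>\<^bsub>GU\<^esub> u \<otimes>\<^bsub>GU\<^esub> inv\<^bsub>GU\<^esub> g \<in> U"
    and "\<theta> (g \<otimes>\<^bsub>GU\<^esub> u \<otimes>\<^bsub>GU\<^esub> inv\<^bsub>GU\<^esub> g) = \<theta> u"
  using assms subsetD[OF subsets_GU(1) assms(1)] by (simp_all add: inv_GU conj_U conj_\<theta>)

lemma comparison_equivariant:
  assumes g: "g \<in> G" and f: "f \<in> carrier I.I"
  shows "comparison (induced_action GU g f) = induced_action (G0\<lparr>carrier := G\<rparr>) g (comparison f)"
proof -
  have GU: "x \<in> G <#> U" if "x \<in> G" for x using that subsets_GU by auto
  have "L.average (induced_action GU g f) = induced_action GU g (L.average f)"
    using g f GU by (intro L.average_conjugate conj_GU) simp_all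
  then show ?thesis
    using g f GU
    by (intro J.induced_eqI)
      (simp_all add: comparison_closed I.induced_action_closed J.induced_action_closed
        comparison_apply J.induced_action_apply I.induced_action_apply)
qed

lemma character_on_subgroup: "\<lbrakk>u \<in> U; w \<in> U\<rbrakk> \<Longrightarrow> \<theta> (u \<otimes> w) = \<theta> u * \<theta> w"
  using L.character_mult by simp

lemma character_one: "\<theta> \<one> = 1"
  using character_on_subgroup[of \<one> \<one>] L.character_nonzero[of \<one>] by simp

text \<open>
  The eigenvector in the class \<open>\<phi>(g)\<close>. This choice, unlike an arbitrary one, is compatible with the
  actions of \<open>H\<close> and \<open>U\<^sub>0\<close>.
\<close>

definition representative :: "('g \<Rightarrow> 'v set) \<Rightarrow> 'g \<Rightarrow> 'v"
  where "representative \<phi> g = quotient_lift R.average (\<phi> g)"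

lemma representative:
  assumes \<phi>: "\<phi> \<in> carrier J.I" and g: "g \<in> G"
  shows representative_closed: "representative \<phi> g \<in> carrier V"
    and representative_eigen:
      "u \<in> U0 \<Longrightarrow> \<rho> u (representative \<phi> g) = \<theta> u \<odot>\<^bsub>V\<^esub> representative \<phi> g"
    and representative_coset: "R.K +>\<^bsub>V\<^esub> representative \<phi> g = \<phi> g"
    and representative_left:
      "h \<in> H \<Longrightarrow> representative \<phi> (h \<otimes> g) = \<rho> h (representative \<phi> g)"
proof -
  have lift: "quotient_lift R.average (R.K +>\<^bsub>V\<^esub> x) = R.average x" if "x \<in> carrier V" for x
    by (rule C.quotient_lift_coset[OF R.average_hom I.H.is_complex_vectorspace _ that])
      (use R.twisted_kernel_eq in blast)
  have "\<phi> g \<in> carrier C.Q" using \<phi> g by simp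
  then obtain x where x: "x \<in> carrier V" "\<phi> g = R.K +>\<^bsub>V\<^esub> x"
    unfolding C.carrier_quotient by blast
  then have F: "representative \<phi> g = R.average x" by (simp add: representative_def lift)
  show "representative \<phi> g \<in> carrier V" using x by (simp add: F)
  show "\<rho> u (representative \<phi> g) = \<theta> u \<odot>\<^bsub>V\<^esub> representative \<phi> g" if "u \<in> U0"
    using R.average_eigen[OF that x(1)] that by (simp add: F)
  have "R.average (R.average x) = R.average x"
    using x by (intro R.average_fixes_eigen R.average_eigen) simp_all
  then have "R.average (R.average x \<ominus>\<^bsub>V\<^esub> x) = \<zero>\<^bsub>V\<^esub>"
    using x by (simp add: R.average.map_minus)
  moreover have "R.average x \<ominus>\<^bsub>V\<^esub> x \<in> carrier V"
    using x by simp
  ultimately have "R.average x \<ominus>\<^bsub>V\<^esub> x \<in> R.K"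
    using R.twisted_kernel_eq by blast
  then show "R.K +>\<^bsub>V\<^esub> representative \<phi> g = \<phi> g"
    using x by (simp add: F C.coset_eq_iff)
  assume h: "h \<in> H"
  have "\<phi> (h \<otimes> g) = \<rho>\<^sub>C h (\<phi> g)" using J.induced_left[OF \<phi> h, of g] g by simp
  moreover have "h \<in> H <#> U0" using h subsets_HU0 by auto
  ultimately show "representative \<phi> (h \<otimes> g) = \<rho> h (representative \<phi> g)"
    using x h by (simp add: F representative_def coinvariant_action_coset lift R_average_H)
qed

text \<open>
  The step that uses \<open>G \<inter> U \<subseteq> H \<inter> U\<^sub>0\<close>: the conjugate \<open>gkg\<^sup>-\<^sup>1\<close> is in \<open>H\<close>, so it comes out of the
  argument as \<open>\<rho>(gkg\<^sup>-\<^sup>1)\<close>, and in \<open>U\<^sub>0\<close>, so it then acts by the scalar \<open>\<theta> k\<close>.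
\<close>

lemma representative_right:
  assumes \<phi>: "\<phi> \<in> carrier J.I" and g: "g \<in> G" and k: "k \<in> G \<inter> U"
  shows "representative \<phi> (g \<otimes> k) = \<theta> k \<odot>\<^bsub>V\<^esub> representative \<phi> g"
proof -
  let ?k = "g \<otimes> k \<otimes> inv g"
  have "?k \<in> G \<inter> U" using g k conj_U by simp
  then have k': "?k \<in> H" "?k \<in> U0" using intersection by auto
  have "g \<otimes> k = ?k \<otimes> g" using g k by (simp add: m_assoc)
  then show ?thesis
    using representative_left[OF \<phi> g k'(1)] representative_eigen[OF \<phi> g k'(2)] conj_\<theta>[of g k] g k
    by simp
qed

text \<open>
  The extension of the representatives from \<open>G\<close> to an eigenfunction on \<open>GU\<close>, through an arbitrary
  choice of factorization.
\<close>

definition extension :: "('g \<Rightarrow> 'v set) \<Rightarrow> 'g \<Rightarrow> 'v"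
  where "extension \<phi> = (\<lambda>y \<in> G <#> U.
    let (g, u) = (SOME (g, u). g \<in> G \<and> u \<in> U \<and> y = g \<otimes> u) in \<theta> u \<odot>\<^bsub>V\<^esub> representative \<phi> g)"

text \<open>
  Two factorizations \<open>gu = g'u'\<close> differ by \<open>k = g'\<^sup>-\<^sup>1g = u'u\<^sup>-\<^sup>1 \<in> G \<inter> U\<close>, and \<open>\<theta>(k)\<close> can be moved
  between the factors by \<open>representative_right\<close>.
\<close>

lemma extension_apply:
  assumes \<phi>: "\<phi> \<in> carrier J.I" and g: "g \<in> G" and u: "u \<in> U"
  shows "extension \<phi> (g \<otimes> u) = \<theta> u \<odot>\<^bsub>V\<^esub> representative \<phi> g"
proof -
  define p where "p = (SOME (g', u'). g' \<in> G \<and> u' \<in> U \<and> g \<otimes> u = g' \<otimes> u')"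
  obtain g' u' where p: "p = (g', u')" by (cases p)
  have "case p of (g', u') \<Rightarrow> g' \<in> G \<and> u' \<in> U \<and> g \<otimes> u = g' \<otimes> u'"
    unfolding p_def by (rule someI[of _ "(g, u)"]) (use g u in simp)
  then have *: "g' \<in> G" "u' \<in> U" "g \<otimes> u = g' \<otimes> u'" by (simp_all add: p)
  define k where "k = inv g' \<otimes> g"
  have "k = inv g' \<otimes> (g \<otimes> u) \<otimes> inv u" using g u *(1) by (simp add: k_def m_assoc)
  also have "\<dots> = u' \<otimes> inv u" using g u * by (simp add: m_assoc mult_inv_cancel_left)
  finally have k': "k = u' \<otimes> inv u" .
  have "k \<in> G" using g *(1) by (simp add: k_def)
  moreover have "k \<in> U" using u *(2) by (simp add: k')
  ultimately have k: "k \<in> G \<inter> U" by simp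
  have "g = g' \<otimes> k" using g *(1) unfolding k_def by (simp add: mult_inv_cancel_left)
  moreover have "u' = k \<otimes> u" using u *(2) by (simp add: k' m_assoc)
  ultimately have "\<theta> u' \<odot>\<^bsub>V\<^esub> representative \<phi> g' = \<theta> u \<odot>\<^bsub>V\<^esub> representative \<phi> g"
    using k u representative_right[OF \<phi> *(1) k] representative_closed[OF \<phi> *(1)]
    by (simp add: character_on_subgroup mult.commute)
  with g u show ?thesis
    by (simp add: extension_def product_memI p p_def[symmetric])
qed

lemma extension_eigenfunction:
  assumes \<phi>: "\<phi> \<in> carrier J.I"
  shows "extension \<phi> \<in> eigenfunctions"
proof -
  have "restrict (extension \<phi>) (carrier GU) \<in> carrier I.I"
  proof (rule I.restrict_inducedI)
    fix y assume "y \<in> carrier GU"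
    then show "extension \<phi> y \<in> carrier V"
      using representative_closed[OF \<phi>] by (auto elim!: product_memE simp: extension_apply[OF \<phi>])
  next
    fix x y assume "x \<in> H <#> U0" and "y \<in> carrier GU"
    then obtain h w g u where *: "h \<in> H" "w \<in> U0" "x = h \<otimes> w" "g \<in> G" "u \<in> U" "y = g \<otimes> u"
      by (auto elim!: product_memE) (auto simp: set_mult_def)
    have HU0: "h \<in> H <#> U0" "w \<in> H <#> U0" using * subsets_HU0 by auto
    let ?w = "inv g \<otimes> w \<otimes> g"
    have w: "?w \<in> U" "\<theta> ?w = \<theta> w"
      using conj_U[of "inv g" w] conj_\<theta>[of "inv g" w] * by simp_all
    \<comment> \<open>bring \<open>hwgu\<close> into the form of an element of \<open>G\<close> times an element of \<open>U\<close>\<close>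
    have "x \<otimes> y = (h \<otimes> g) \<otimes> (?w \<otimes> u)"
      using * by (simp add: m_assoc mult_inv_cancel_left)
    then have "extension \<phi> (x \<otimes> y) = (\<theta> w * \<theta> u) \<odot>\<^bsub>V\<^esub> \<rho> h (representative \<phi> g)"
      using * w by (simp add: extension_apply[OF \<phi>] character_on_subgroup representative_left[OF \<phi>])
    also have "\<dots> = \<rho> x (extension \<phi> y)"
      using * HU0 representative_closed[OF \<phi> *(4)]
        fd_representation.action_mult[OF rep, of h w "extension \<phi> y"]
      by (simp add: extension_apply[OF \<phi>] complex_linear_map.map_scale[OF I.H_linear]
          representative_eigen[OF \<phi>] mult.commute)
    finally show "extension \<phi> (x \<otimes>\<^bsub>GU\<^esub> y) = \<rho> x (extension \<phi> y)" by simp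
  qed
  moreover have "restrict (extension \<phi>) (carrier GU) = extension \<phi>"
    by (simp add: extension_def)
  moreover have "extension \<phi> (y \<otimes> w) = \<theta> w \<odot>\<^bsub>V\<^esub> extension \<phi> y" if "y \<in> G <#> U" "w \<in> U" for y w
  proof -
    obtain g u where *: "g \<in> G" "u \<in> U" "y = g \<otimes> u" by (rule product_memE[OF \<open>y \<in> G <#> U\<close>])
    then have "y \<otimes> w = g \<otimes> (u \<otimes> w)" using that by (simp add: m_assoc)
    with * that show ?thesis
      by (simp add: extension_apply[OF \<phi>] character_on_subgroup representative_closed[OF \<phi>]
          mult.commute)
  qed
  ultimately show ?thesis by (simp add: eigenfunctions_def)
qed

lemma comparison_surjective: "comparison ` carrier I.I = carrier J.I"
proof
  show "comparison ` carrier I.I \<subseteq> carrier J.I" using comparison_closed by blast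
  show "carrier J.I \<subseteq> comparison ` carrier I.I"
  proof
    fix \<phi> assume \<phi>: "\<phi> \<in> carrier J.I"
    have f: "extension \<phi> \<in> carrier I.I"
      using extension_eigenfunction[OF \<phi>] by (simp add: eigenfunctions_def)
    have "comparison (extension \<phi>) = \<phi>"
    proof (rule J.induced_eqI)
      fix g assume "g \<in> carrier (G0\<lparr>carrier := G\<rparr>)"
      then have g: "g \<in> G" by simp
      have "extension \<phi> g = representative \<phi> g"
        using extension_apply[OF \<phi> g closed(2)] g representative_closed[OF \<phi> g]
        by (simp add: character_one)
      with g show "comparison (extension \<phi>) g = \<phi> g"
        by (simp add: comparison_apply average_of_eigenfunction[OF extension_eigenfunction[OF \<phi>]]
            representative_coset[OF \<phi>])
    qed (use \<phi> f in \<open>simp_all add: comparison_closed\<close>)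
    with f show "\<phi> \<in> comparison ` carrier I.I" by (metis imageI)
  qed
qed

text \<open>
  The stability of the twisted kernel under \<open>G\<close> is that of the kernel of averaging, which commutes
  with everything normalizing \<open>U\<close> and \<open>\<theta>\<close>.
\<close>

lemma coinvariants_of_induced:
  "isomorphic_representations (G0\<lparr>carrier := G\<rparr>)
    (coinvariant_space I.I (induced_action GU) U \<theta>)
    (coinvariant_action I.I (induced_action GU) U \<theta>)
    J.I (induced_action (G0\<lparr>carrier := G\<rparr>))"
proof -
  have "induced_action GU g ` L.K \<subseteq> L.K" if "g \<in> G" for g
    using that subsets_GU by (intro L.twisted_kernel_stable conj_GU) auto
  then have "isomorphic_representations (GU\<lparr>carrier := G\<rparr>)
      (quotient_space I.I L.K) (quotient_action I.I L.K (induced_action GU))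
      J.I (induced_action (G0\<lparr>carrier := G\<rparr>))"
    using J.fd_representation_induced
    by (intro isomorphic_quotientI[where T = comparison] I.fd_representation_induced subgroups_GU
        L.twisted_kernel_subspace comparison_hom comparison_surjective comparison_kernel
        comparison_equivariant) simp_all
  then show ?thesis by (simp add: coinvariant_space_def coinvariant_action_def)
qed

end

theorem proposition4p15:
  fixes G0 :: "('g, 'm) monoid_scheme"
    and G U H U0 :: "'g set"
    and \<theta> \<theta>0 :: "'g \<Rightarrow> complex"
    and V :: "(complex, 'v, 'n) module_scheme"
    and \<rho> :: "'g \<Rightarrow> 'v \<Rightarrow> 'v"
  assumes "group G0" and "finite (carrier G0)"
    and "subgroup G G0" and "subgroup U G0"
    and "is_character (G0\<lparr>carrier := U\<rparr>) \<theta>"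
    and "normalizes_subgroup G0 G U" and "normalizes_character G0 G U \<theta>"
    and "subgroup H (G0\<lparr>carrier := G\<rparr>)" and "subgroup U0 (G0\<lparr>carrier := U\<rparr>)"
    and "\<theta>0 = restrict \<theta> U0"
    and "normalizes_subgroup G0 H U0" and "normalizes_character G0 H U0 \<theta>0"
    and "G \<inter> U \<subseteq> H \<inter> U0"
    and "fd_representation (G0\<lparr>carrier := H <#>\<^bsub>G0\<^esub> U0\<rparr>) V \<rho>"
  shows "isomorphic_representations (G0\<lparr>carrier := G\<rparr>)
    (coinvariant_space
      (induced_space (G0\<lparr>carrier := G <#>\<^bsub>G0\<^esub> U\<rparr>) (H <#>\<^bsub>G0\<^esub> U0) V \<rho>)
      (induced_action (G0\<lparr>carrier := G <#>\<^bsub>G0\<^esub> U\<rparr>)) U \<theta>)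
    (coinvariant_action
      (induced_space (G0\<lparr>carrier := G <#>\<^bsub>G0\<^esub> U\<rparr>) (H <#>\<^bsub>G0\<^esub> U0) V \<rho>)
      (induced_action (G0\<lparr>carrier := G <#>\<^bsub>G0\<^esub> U\<rparr>)) U \<theta>)
    (induced_space (G0\<lparr>carrier := G\<rparr>) H
      (coinvariant_space V \<rho> U0 \<theta>0) (coinvariant_action V \<rho> U0 \<theta>0))
    (induced_action (G0\<lparr>carrier := G\<rparr>))"
proof -
  interpret G0: group G0 by fact
  have sub: "subgroup H G0" "subgroup U0 G0"
    using G0.incl_subgroup assms(3,4,8,9) by blast+
  have "H \<subseteq> G" "U0 \<subseteq> U"
    using subgroup.subset[OF assms(8)] subgroup.subset[OF assms(9)] by simp_all
  then have "induced_coinvariants G0 G U H U0 \<theta> V \<rho>"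
    using assms(2-7,11,13,14) sub assms(1)
    by (auto simp: induced_coinvariants_def induced_coinvariants_axioms_def
        normalizes_character_def intro: G0.normalizes_subgroup_conjugate)
  from induced_coinvariants.coinvariants_of_induced[OF this]
  show ?thesis unfolding \<open>\<theta>0 = restrict \<theta> U0\<close> coinvariant_space_def .
qed

end
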